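(* Let $p>3$ be a prime with $p\equiv 1\pmod 5$, and let $\mathbb{F}_{p^{15}}$ be represented by the tower $\mathbb{F}_{p^5}=\mathbb{F}_p[u]$ with $u^5=7$, and $\mathbb{F}_{p^{15}}=\mathbb{F}_{p^5}[v]$ with $v^3=u$, where $p$ is such that $X^5-7$ is irreducible over $\mathbb{F}_p$ and $X^3-u$ is irreducible over $\mathbb{F}_{p^5}$. Then, in the finite field $\mathbb{F}_{p^{15}}$: (1) The computation of each of the $p^5$- and $p^{10}$-Frobenius maps costs $10M_1$. (2) The computation of each of the $p$-, $p^2$-, $p^3$-, $p^4$-, $p^6$-, $p^7$-, $p^8$- and $p^9$-Frobenius maps costs $14M_1$. (3) The inverse of an element $\alpha$ of the cyclotomic subgroup $G_{\phi_3(p^5)}$ is computed as $\alpha^{-1}=\alpha^{p^5}\cdot\alpha^{p^{10}}$, and the cost is $54S_1$.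
   Context: The $p^i$-Frobenius map on $\mathbb{F}_{p^{15}}$ is $a\mapsto a^{p^i}$. The polynomial $\phi_3(x)=x^2+x+1$ is the third cyclotomic polynomial, and $G_{\phi_3(p^5)}=\{a\in\mathbb{F}_{p^{15}}^{\ast} : a^{p^{10}+p^5+1}=1\}$ is the subgroup of $\mathbb{F}_{p^{15}}^{\ast}$ of order $\phi_3(p^5)=p^{10}+p^5+1$. Elements of $\mathbb{F}_{p^{15}}$ are given by their 15 coordinates in $\mathbb{F}_p$ with respect to the basis $u^iv^j$, $0\le i\le 4$, $0\le j\le 2$, and the result of a computation must be given in the same form. $M_1$ and $S_1$ denote the cost of one multiplication and one squaring in $\mathbb{F}_p$, respectively. Saying that a computation costs $xM_1+yS_1$ means that it can be carried out on coordinates by a fixed sequence of arithmetic operations in $\mathbb{F}_p$ using $x$ multiplications and $y$ squarings (an operation count as an upper bound). Not counted are additions, subtractions, and multiplications by fixed small rational constants independent of $p$, such as $7$ or $1/2$. Constants of $\mathbb{F}_p$ depending only on $p$ and on the tower (such as powers of roots of unity) may be precomputed for free, but multiplying a coordinate by such a constant counts as one multiplication $M_1$. *)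

theory Defs
  imports "HOL-Algebra.Algebra" "HOL-Algebra.Finite_Extensions" "HOL-Number_Theory.Cong"
begin

section \<open>The tower\<close>

text \<open>The field with \<open>p\<close> elements is a subfield \<open>K\<close> of \<open>L\<close>. Univariate polynomials are
  coefficient lists with the leading coefficient first.\<close>

locale tower15 = field L for L (structure) +
  fixes p :: nat and K :: "'a set" and u v :: 'a
  assumes p_prime: "Factorial_Ring.prime p"
    and p_gt_3: "p > 3"
    and p_cong: "[p = 1] (mod 5)"
    and subfield_K: "subfield K L"
    and card_K: "card K = p"
    and u_carrier: "u \<in> carrier L"
    and u_pow: "u [^] (5::nat) = [(7::nat)] \<cdot> \<one>"
    and irreducible_u: "pirreducible K [\<one>, \<zero>, \<zero>, \<zero>, \<zero>, \<ominus> ([(7::nat)] \<cdot> \<one>)]"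
    and v_carrier: "v \<in> carrier L"
    and v_pow: "v [^] (3::nat) = u"
    and irreducible_v: "pirreducible (simple_extension K u) [\<one>, \<zero>, \<zero>, \<ominus> u]"
    and carrier_eq: "carrier L = simple_extension (simple_extension K u) v"

definition tower_basis :: "('a, 'b) ring_scheme \<Rightarrow> 'a \<Rightarrow> 'a \<Rightarrow> 'a list" where
  "tower_basis L u v = [u [^]\<^bsub>L\<^esub> i \<otimes>\<^bsub>L\<^esub> v [^]\<^bsub>L\<^esub> j. i \<leftarrow> [0..<5::nat], j \<leftarrow> [0..<3::nat]]"

definition of_coords :: "('a, 'b) ring_scheme \<Rightarrow> 'a \<Rightarrow> 'a \<Rightarrow> 'a list \<Rightarrow> 'a" where
  "of_coords L u v xs = ring.combine L xs (tower_basis L u v)"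

definition frobenius :: "nat \<Rightarrow> nat \<Rightarrow> ('a, 'b) ring_scheme \<Rightarrow> 'a \<Rightarrow> 'a" where
  "frobenius i p L \<alpha> = \<alpha> [^]\<^bsub>L\<^esub> (p ^ i)"

definition G_phi3 :: "nat \<Rightarrow> ('a, 'b) ring_scheme \<Rightarrow> 'a set" where
  "G_phi3 p L = {\<alpha> \<in> carrier L - {\<zero>\<^bsub>L\<^esub>}. \<alpha> [^]\<^bsub>L\<^esub> (p ^ 10 + p ^ 5 + 1) = \<one>\<^bsub>L\<^esub>}"


section \<open>Straight-line programs\<close>

text \<open>Registers hold field elements and are never overwritten: registers \<open>0..14\<close> are the input
  coordinates, and each instruction appends one register. \<open>Scale q i\<close> multiplies register \<open>i\<close> by
  a rational constant fixed in the program; \<open>Const k\<close> loads the \<open>k\<close>-th precomputed constant, so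
  multiplying a register by it takes a \<open>Mult\<close>.\<close>

datatype instr =
    Add nat nat
  | Sub nat nat
  | Scale rat nat
  | Const nat
  | Mult nat nat
  | Square nat

text \<open>The second component lists the registers holding the 15 output coordinates.\<close>

type_synonym slp = "instr list \<times> nat list"

primrec operands :: "instr \<Rightarrow> nat set" where
  "operands (Add i j) = {i, j}"
| "operands (Sub i j) = {i, j}"
| "operands (Scale q i) = {i}"
| "operands (Const k) = {}"
| "operands (Mult i j) = {i, j}"
| "operands (Square i) = {i}"

definition wf_slp :: "slp \<Rightarrow> bool" where
  "wf_slp P \<longleftrightarrow>
     (\<forall>n < length (fst P). operands (fst P ! n) \<subseteq> {..<15 + n}) \<and>
     length (snd P) = 15 \<and> set (snd P) \<subseteq> {..<15 + length (fst P)}"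

primrec is_Mult :: "instr \<Rightarrow> bool" where
  "is_Mult (Add i j) = False"
| "is_Mult (Sub i j) = False"
| "is_Mult (Scale q i) = False"
| "is_Mult (Const k) = False"
| "is_Mult (Mult i j) = True"
| "is_Mult (Square i) = False"

primrec is_Square :: "instr \<Rightarrow> bool" where
  "is_Square (Add i j) = False"
| "is_Square (Sub i j) = False"
| "is_Square (Scale q i) = False"
| "is_Square (Const k) = False"
| "is_Square (Mult i j) = False"
| "is_Square (Square i) = True"

definition num_mults :: "slp \<Rightarrow> nat" where
  "num_mults P = length (filter is_Mult (fst P))"

definition num_squares :: "slp \<Rightarrow> nat" where
  "num_squares P = length (filter is_Square (fst P))"

definition rat_const :: "('a, 'b) ring_scheme \<Rightarrow> rat \<Rightarrow> 'a" where
  "rat_const R q =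
     ([fst (quotient_of q)] \<cdot>\<^bsub>R\<^esub> \<one>\<^bsub>R\<^esub>) \<otimes>\<^bsub>R\<^esub> inv\<^bsub>R\<^esub> ([snd (quotient_of q)] \<cdot>\<^bsub>R\<^esub> \<one>\<^bsub>R\<^esub>)"

text \<open>No denominator of a rational constant of the program vanishes in \<open>R\<close>; otherwise
  \<open>rat_const\<close> is meaningless.\<close>

definition rats_defined :: "('a, 'b) ring_scheme \<Rightarrow> slp \<Rightarrow> bool" where
  "rats_defined R P \<longleftrightarrow>
     (\<forall>q i. Scale q i \<in> set (fst P) \<longrightarrow> [snd (quotient_of q)] \<cdot>\<^bsub>R\<^esub> \<one>\<^bsub>R\<^esub> \<noteq> \<zero>\<^bsub>R\<^esub>)"

primrec exec :: "('a, 'b) ring_scheme \<Rightarrow> (nat \<Rightarrow> 'a) \<Rightarrow> 'a list \<Rightarrow> instr \<Rightarrow> 'a" where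
  "exec R c rs (Add i j) = rs ! i \<oplus>\<^bsub>R\<^esub> rs ! j"
| "exec R c rs (Sub i j) = rs ! i \<ominus>\<^bsub>R\<^esub> rs ! j"
| "exec R c rs (Scale q i) = rat_const R q \<otimes>\<^bsub>R\<^esub> rs ! i"
| "exec R c rs (Const k) = c k"
| "exec R c rs (Mult i j) = rs ! i \<otimes>\<^bsub>R\<^esub> rs ! j"
| "exec R c rs (Square i) = rs ! i \<otimes>\<^bsub>R\<^esub> rs ! i"

definition run :: "('a, 'b) ring_scheme \<Rightarrow> (nat \<Rightarrow> 'a) \<Rightarrow> slp \<Rightarrow> 'a list \<Rightarrow> 'a list" where
  "run R c P xs =
     (let rs = foldl (\<lambda>rs ins. rs @ [exec R c rs ins]) xs (fst P) in map ((!) rs) (snd P))"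

definition computes ::
    "('a, 'b) ring_scheme \<Rightarrow> 'a set \<Rightarrow> 'a \<Rightarrow> 'a \<Rightarrow> (nat \<Rightarrow> 'a) \<Rightarrow> slp \<Rightarrow> 'a set \<Rightarrow> ('a \<Rightarrow> 'a) \<Rightarrow> bool"
where
  "computes L K u v c P A f \<longleftrightarrow>
     (\<forall>xs. length xs = 15 \<longrightarrow> set xs \<subseteq> K \<longrightarrow> of_coords L u v xs \<in> A \<longrightarrow>
        set (run L c P xs) \<subseteq> K \<and> of_coords L u v (run L c P xs) = f (of_coords L u v xs))"

text \<open>The program, including its rational constants, is chosen before \<open>p\<close> and the tower, hence
  is independent of them; only the precomputed constants \<open>c\<close> may depend on \<open>p\<close> and the tower.\<close>

definition costs ::
    "(nat \<Rightarrow> 'a ring \<Rightarrow> 'a set) \<Rightarrow> (nat \<Rightarrow> 'a ring \<Rightarrow> 'a \<Rightarrow> 'a) \<Rightarrow> nat \<Rightarrow> nat \<Rightarrow> bool"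
where
  "costs A f x y \<longleftrightarrow>
     (\<exists>P. wf_slp P \<and> num_mults P \<le> x \<and> num_squares P \<le> y \<and>
        (\<forall>p L K u v. tower15 L p K u v \<longrightarrow>
           rats_defined L P \<and>
           (\<exists>c. range c \<subseteq> K \<and> computes L K u v c P (A p L) (f p L))))"

end

theory Submission
  imports Defs
begin

text \<open>
  Since \<open>v\<^sup>3 = u\<close>, the basis \<open>u\<^sup>i v\<^sup>j\<close> consists of the powers \<open>v\<^sup>m\<close> with \<open>m = 3 i + j < 15\<close>, and
  \<open>v\<^sup>1\<^sup>5 = 7\<close>. Irreducibility of \<open>X\<^sup>3 - u\<close> means that \<open>u\<close> is not a cube in
  \<open>K(u)\<close>, which forces \<open>p\<close> to be 1 modulo 3 (\<open>three_dvd\<close>), hence modulo 15. So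
  \<open>v\<^sup>p = \<zeta> v\<close> with a 15th root of unity \<open>\<zeta> = 7\<^bsup>(p - 1) / 15\<^esup>\<close> in \<open>K\<close>.

  The \<open>p\<^sup>i\<close>-Frobenius map fixes \<open>K\<close> and is additive, so it multiplies the coordinate \<open>m\<close> by
  \<open>\<zeta>\<^bsup>i m\<^esup>\<close> (\<open>frobenius_of_coords\<close>). This is free for \<open>m = 0\<close>, leaving 14 multiplications; if 5 divides
  \<open>i\<close>, it is free for all five multiples \<open>m\<close> of 3, leaving 10.

  On \<open>G_phi3\<close> the product of \<open>\<alpha>\<close> and its two conjugates under the \<open>p\<^sup>5\<close>-Frobenius map is 1 by
  definition, which gives the formula for the inverse. Write \<open>\<alpha> = A\<^sub>0 + A\<^sub>1 v + A\<^sub>2 v\<^sup>2\<close> with \<open>A\<^sub>j\<close> in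
  \<open>K(u)\<close>. The map multiplies \<open>v\<close> by \<open>\<omega> = \<zeta>\<^sup>5\<close>, which is a primitive cube root of unity as \<open>u\<close> is not a
  cube (\<open>\<zeta>_pow5\<close>), and so the product of the two conjugates of \<open>\<alpha>\<close> is
    \<open>(A\<^sub>0\<^sup>2 - u A\<^sub>1 A\<^sub>2) + (u A\<^sub>2\<^sup>2 - A\<^sub>0 A\<^sub>1) v + (A\<^sub>1\<^sup>2 - A\<^sub>0 A\<^sub>2) v\<^sup>2\<close>
  (\<open>frobenius_product\<close>). As \<open>2 A\<^sub>i A\<^sub>j = (A\<^sub>i + A\<^sub>j)\<^sup>2 - A\<^sub>i\<^sup>2 - A\<^sub>j\<^sup>2\<close>, six squarings in
  \<open>K(u)\<close> suffice: those of the \<open>A\<^sub>j\<close> and of their pairwise sums (\<open>squares_identity\<close>). An element of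
  \<open>K(u)\<close> is the value at \<open>u\<close> of a polynomial of degree at most 4. The square of the polynomial has
  degree at most 8 and is determined by its values at \<open>0, \<dots>, 8\<close>; these are 9 squares in \<open>K\<close>, and
  Lagrange interpolation recovers the square at \<open>u\<close> from them with rational weights whose
  denominators divide \<open>8!\<close> (\<open>quadrature_square\<close>, \<open>lagrange_quadrature\<close>). These are invertible in \<open>K\<close>
  as \<open>p > 15\<close>. Altogether the inverse has coordinates that are rational combinations of
  \<open>6 \<sqdot> 9 = 54\<close> squares of linear forms in the coordinates of \<open>\<alpha>\<close>.
\<close>


section \<open>Straight-line programs\<close>

text \<open>The registers after running an instruction list on the registers \<open>rs\<close>.\<close>

abbreviation exec_all ::
    "('a, 'b) ring_scheme \<Rightarrow> (nat \<Rightarrow> 'a) \<Rightarrow> 'a list \<Rightarrow> instr list \<Rightarrow> 'a list" where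
  "exec_all R c \<equiv> foldl (\<lambda>rs ins. rs @ [exec R c rs ins])"

lemma exec_append:
  assumes "operands ins \<subseteq> {..<length rs}"
  shows "exec R c (rs @ ss) ins = exec R c rs ins"
  using assms by (cases ins) (auto simp: nth_append)

lemma exec_all_independent:
  assumes "\<And>ins. ins \<in> set is \<Longrightarrow> operands ins \<subseteq> {..<length rs}"
  shows "exec_all R c rs is = rs @ map (exec R c rs) is"
  using assms
proof (induction "is" rule: rev_induct)
  case (snoc i "is")
  then show ?case by (simp add: exec_append)
qed simp

text \<open>The instruction list reads no register before it is written, when \<open>N\<close> registers are already
  in use.\<close>

definition wf_from :: "nat \<Rightarrow> instr list \<Rightarrow> bool" where
  "wf_from N is \<longleftrightarrow> (\<forall>n < length is. operands (is ! n) \<subseteq> {..<N + n})"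

lemma wf_from_Nil [simp]: "wf_from N []"
  by (simp add: wf_from_def)

lemma wf_from_append [simp]:
  "wf_from N (is @ js) \<longleftrightarrow> wf_from N is \<and> wf_from (N + length is) js"
proof
  assume *: "wf_from N (is @ js)"
  have "operands (is ! n) \<subseteq> {..<N + n}" if "n < length is" for n
    using * that unfolding wf_from_def by (auto simp: nth_append dest!: spec[of _ n])
  moreover have "operands (js ! n) \<subseteq> {..<N + length is + n}" if "n < length js" for n
    using * that unfolding wf_from_def
    by (auto simp: nth_append add.assoc dest!: spec[of _ "length is + n"])
  ultimately show "wf_from N is \<and> wf_from (N + length is) js"
    by (simp add: wf_from_def)
next
  assume *: "wf_from N is \<and> wf_from (N + length is) js"
  show "wf_from N (is @ js)"
    unfolding wf_from_def
  proof (intro allI impI)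
    fix n assume n: "n < length (is @ js)"
    show "operands ((is @ js) ! n) \<subseteq> {..<N + n}"
    proof (cases "n < length is")
      case True
      with * show ?thesis by (simp add: wf_from_def nth_append)
    next
      case False
      with n have "n - length is < length js" by simp
      with * have "operands (js ! (n - length is)) \<subseteq> {..<N + length is + (n - length is)}"
        unfolding wf_from_def by blast
      with False show ?thesis by (simp add: nth_append)
    qed
  qed
qed

lemma wf_from_independent:
  assumes "\<And>ins. ins \<in> set is \<Longrightarrow> operands ins \<subseteq> {..<N}"
  shows "wf_from N is"
  unfolding wf_from_def
proof (intro allI impI)
  fix n assume "n < length is"
  then have "operands (is ! n) \<subseteq> {..<N}" using assms by simp
  then show "operands (is ! n) \<subseteq> {..<N + n}" by auto
qed

text \<open>Instructions that leave the sum of \<open>q i\<close> times register \<open>r i\<close>, over \<open>i < k\<close>, in the last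
  register, when \<open>N\<close> registers are already in use. The initial \<open>Scale 0 0\<close> produces the zero
  that the summation starts from.\<close>

primrec lin_comb :: "nat \<Rightarrow> (nat \<Rightarrow> rat) \<Rightarrow> (nat \<Rightarrow> nat) \<Rightarrow> nat \<Rightarrow> instr list" where
  "lin_comb N q r 0 = [Scale 0 0]"
| "lin_comb N q r (Suc k) =
     lin_comb N q r k @ [Scale (q k) (r k), Add (N + 2 * k) (N + 2 * k + 1)]"

text \<open>The linear combinations with coefficients \<open>q j\<close> for \<open>j < n\<close>, one after the other; all of
  them have \<open>k\<close> terms and read the same registers.\<close>

primrec lin_combs ::
    "nat \<Rightarrow> (nat \<Rightarrow> nat \<Rightarrow> rat) \<Rightarrow> (nat \<Rightarrow> nat) \<Rightarrow> nat \<Rightarrow> nat \<Rightarrow> instr list" where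
  "lin_combs N q r k 0 = []"
| "lin_combs N q r k (Suc n) =
     lin_combs N q r k n @ lin_comb (N + (2 * k + 1) * n) (q n) r k"

lemma length_lin_comb [simp]: "length (lin_comb N q r k) = 2 * k + 1"
  by (induction k) auto

lemma length_lin_combs [simp]: "length (lin_combs N q r k n) = (2 * k + 1) * n"
  by (induction n) auto

lemma set_lin_comb_Scale:
  "Scale s i \<in> set (lin_comb N q r k) \<Longrightarrow> s = 0 \<or> (\<exists>m < k. s = q m)"
  by (induction k) (auto simp: less_Suc_eq)

lemma set_lin_combs_Scale:
  "Scale s i \<in> set (lin_combs N q r k n) \<Longrightarrow> s = 0 \<or> (\<exists>j < n. \<exists>m < k. s = q j m)"
  by (induction n) (auto simp: less_Suc_eq dest!: set_lin_comb_Scale)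

lemma filter_lin_comb [simp]:
  "filter is_Mult (lin_comb N q r k) = []" "filter is_Square (lin_comb N q r k) = []"
  by (induction k) auto

lemma filter_lin_combs [simp]:
  "filter is_Mult (lin_combs N q r k n) = []" "filter is_Square (lin_combs N q r k n) = []"
  by (induction n) auto

lemma wf_lin_comb:
  assumes "0 < N" "\<And>i. i < k \<Longrightarrow> r i < N"
  shows "wf_from N (lin_comb N q r k)"
  using assms(2)
proof (induction k)
  case 0
  then show ?case using assms(1) by (simp add: wf_from_def)
next
  case (Suc k)
  then have "wf_from N (lin_comb N q r k)" "r k < N" by auto
  then show ?case by (auto simp: wf_from_def nth_append less_Suc_eq)
qed

lemma wf_lin_combs:
  assumes "0 < N" "\<And>i. i < k \<Longrightarrow> r i < N"
  shows "wf_from N (lin_combs N q r k n)"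
proof (induction n)
  case (Suc n)
  have "wf_from (N + (2 * k + 1) * n) (lin_comb (N + (2 * k + 1) * n) (q n) r k)"
    using assms by (intro wf_lin_comb) (auto intro: trans_less_add1)
  with Suc show ?case by simp
qed simp


section \<open>Finite sums and rational constants in rings\<close>

lemma (in abelian_monoid) finsum_swap:
  assumes "finite A" "finite B" "\<And>i j. i \<in> A \<Longrightarrow> j \<in> B \<Longrightarrow> f i j \<in> carrier G"
  shows "(\<Oplus>i\<in>A. \<Oplus>j\<in>B. f i j) = (\<Oplus>j\<in>B. \<Oplus>i\<in>A. f i j)"
  using assms(1,3)
proof (induction A rule: finite_induct)
  case empty
  then show ?case by (simp add: finsum_zero)
next
  case (insert a A)
  have "(\<Oplus>i\<in>insert a A. \<Oplus>j\<in>B. f i j) = (\<Oplus>j\<in>B. f a j) \<oplus> (\<Oplus>j\<in>B. \<Oplus>i\<in>A. f i j)"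
    using insert assms(2) by (subst finsum_insert) (auto intro!: finsum_closed)
  also have "\<dots> = (\<Oplus>j\<in>B. f a j \<oplus> (\<Oplus>i\<in>A. f i j))"
    using insert by (intro finsum_addf[symmetric]) (auto intro!: finsum_closed)
  also have "\<dots> = (\<Oplus>j\<in>B. \<Oplus>i\<in>insert a A. f i j)"
    using insert by (intro finsum_cong') (auto intro!: finsum_closed)
  finally show ?case .
qed

lemma (in abelian_monoid) finsum_lessThan_Suc:
  assumes "\<And>i. i \<le> n \<Longrightarrow> f i \<in> carrier G"
  shows "(\<Oplus>i\<in>{..<Suc n}. f i) = (\<Oplus>i\<in>{..<n}. f i) \<oplus> f n"
proof -
  have "(\<Oplus>i\<in>insert n {..<n}. f i) = f n \<oplus> (\<Oplus>i\<in>{..<n}. f i)"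
    using assms by (intro finsum_insert) auto
  then show ?thesis
    using assms by (simp add: lessThan_Suc a_comm finsum_closed)
qed

lemma (in abelian_monoid) finsum_split_blocks:
  fixes a b :: nat
  assumes "\<And>s. s < a * b \<Longrightarrow> f s \<in> carrier G"
  shows "(\<Oplus>s\<in>{..<a * b}. f s) = (\<Oplus>i\<in>{..<a}. \<Oplus>j\<in>{..<b}. f (b * i + j))"
  using assms
proof (induction a)
  case (Suc a)
  have inner: "f (b * i + j) \<in> carrier G" if "i < Suc a" "j < b" for i j
  proof (rule Suc.prems)
    have "b * i + j < b * Suc i" using that by simp
    also have "\<dots> \<le> b * Suc a" using that by (intro mult_le_mono2) simp
    finally show "b * i + j < Suc a * b" by (simp add: mult.commute)
  qed
  have "{..<Suc a * b} = {..<a * b} \<union> (\<lambda>j. b * a + j) ` {..<b}"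
  proof (intro equalityI subsetI)
    fix s assume "s \<in> {..<Suc a * b}"
    then show "s \<in> {..<a * b} \<union> (\<lambda>j. b * a + j) ` {..<b}"
      by (cases "s < a * b") (auto simp: mult.commute image_iff intro!: bexI[of _ "s - b * a"])
  qed (auto simp: mult.commute)
  then have "(\<Oplus>s\<in>{..<Suc a * b}. f s) =
      (\<Oplus>s\<in>{..<a * b}. f s) \<oplus> (\<Oplus>s\<in>(\<lambda>j. b * a + j) ` {..<b}. f s)"
    using Suc.prems inner by (simp only:) (rule finsum_Un_disjoint, auto simp: mult.commute)
  also have "(\<Oplus>s\<in>(\<lambda>j. b * a + j) ` {..<b}. f s) = (\<Oplus>j\<in>{..<b}. f (b * a + j))"
    using inner by (intro finsum_reindex) (auto simp: inj_on_def)
  also have "(\<Oplus>s\<in>{..<a * b}. f s) = (\<Oplus>i\<in>{..<a}. \<Oplus>j\<in>{..<b}. f (b * i + j))"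
    using Suc.prems by (intro Suc.IH) auto
  finally show ?case
    using inner by (subst finsum_lessThan_Suc) (auto intro!: finsum_closed)
qed (simp add: finsum_zero)

text \<open>The image of an integer in a ring.\<close>

definition (in ring) of_integer :: "int \<Rightarrow> 'a" where
  "of_integer z = add_pow R z \<one>"

lemma (in ring) of_integer_closed [simp]: "of_integer z \<in> carrier R"
  by (simp add: of_integer_def)

lemma (in ring) of_integer_0 [simp]: "of_integer 0 = \<zero>"
  by (simp add: of_integer_def add_pow_def int_pow_def nat_pow_def)

lemma (in ring) of_integer_1 [simp]: "of_integer 1 = \<one>"
  by (simp add: of_integer_def)

lemma (in ring) of_integer_add: "of_integer (a + b) = of_integer a \<oplus> of_integer b"
  by (simp add: of_integer_def add.int_pow_mult)

lemma (in ring) of_integer_minus: "of_integer (- a) = \<ominus> of_integer a"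
  by (simp add: of_integer_def add.int_pow_neg)

lemma (in ring) of_integer_mult: "of_integer (a * b) = of_integer a \<otimes> of_integer b"
  unfolding of_integer_def
  by (simp add: add_pow_ldistr_int add.int_pow_pow mult.commute)

lemma (in ring) of_integer_power: "of_integer (a ^ n) = of_integer a [^] n"
  by (induction n) (simp_all add: of_integer_mult power_Suc2 del: power_Suc)

lemma (in ring) of_integer_sum:
  "finite A \<Longrightarrow> of_integer (sum f A) = (\<Oplus>i\<in>A. of_integer (f i))"
  by (induction A rule: finite_induct) (simp_all add: of_integer_add Pi_def)

lemma (in ring) of_integer_nat: "of_integer (int n) = add_pow R n \<one>"
  by (simp add: of_integer_def add_pow_int_ge)

lemma (in ring) of_integer_in_subring:
  assumes "subring K R"
  shows "of_integer z \<in> K"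
proof -
  have *: "of_integer (int n) \<in> K" for n
    by (induction n) (auto simp: of_integer_add subringE[OF assms])
  show ?thesis
  proof (cases z rule: int_cases2)
    case (nonpos n)
    then show ?thesis using * by (simp add: of_integer_minus subringE[OF assms])
  qed (simp add: *)
qed

text \<open>The fraction \<open>z / d\<close> need not be in lowest terms: its reduced denominator divides \<open>d\<close>.\<close>

lemma (in field) rat_const_fraction:
  assumes "of_integer d \<noteq> \<zero>"
  shows "of_integer (snd (quotient_of (of_int z / of_int d))) \<noteq> \<zero>"
    and "rat_const R (of_int z / of_int d) = of_integer z \<otimes> inv (of_integer d)"
proof -
  obtain a b where ab: "quotient_of (of_int z / of_int d) = (a, b)" by fastforce
  have "d \<noteq> 0" using assms by auto
  have "b > 0" "coprime a b" and eq: "of_int z / of_int d = (of_int a / of_int b :: rat)"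
    using quotient_of_denom_pos[OF ab] quotient_of_coprime[OF ab] quotient_of_div[OF ab] by auto
  have "(of_int (z * b) :: rat) = of_int (a * d)"
    using eq \<open>d \<noteq> 0\<close> \<open>b > 0\<close> by (simp add: field_simps)
  then have zb: "z * b = a * d" by linarith
  then have "b dvd d"
    using \<open>coprime a b\<close> by (metis coprime_commute coprime_dvd_mult_right_iff dvd_triv_right)
  then show b: "of_integer (snd (quotient_of (of_int z / of_int d))) \<noteq> \<zero>"
    using assms by (auto simp: ab of_integer_mult)
  have zb': "of_integer z \<otimes> of_integer b = of_integer a \<otimes> of_integer d"
    using zb by (metis of_integer_mult)
  have d': "inv (of_integer d) \<in> carrier R" "of_integer d \<otimes> inv (of_integer d) = \<one>"
    using assms field_Units by auto
  have b': "inv (of_integer b) \<in> carrier R" "of_integer b \<otimes> inv (of_integer b) = \<one>"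
    using b field_Units by (auto simp: ab)
  have "of_integer a \<otimes> inv (of_integer b) =
      (of_integer a \<otimes> of_integer d) \<otimes> (inv (of_integer d) \<otimes> inv (of_integer b))"
    using d' b' by (simp add: m_assoc flip: m_assoc[of "of_integer d"])
  also have "\<dots> = of_integer z \<otimes> inv (of_integer d) \<otimes> (of_integer b \<otimes> inv (of_integer b))"
    using d'(1) b'(1) unfolding zb'[symmetric] by (simp only: m_ac m_closed of_integer_closed)
  finally have "of_integer a \<otimes> inv (of_integer b) = of_integer z \<otimes> inv (of_integer d)"
    using d' b' by simp
  then show "rat_const R (of_int z / of_int d) = of_integer z \<otimes> inv (of_integer d)"
    by (simp add: rat_const_def ab of_integer_def)
qed

lemma (in ring) rat_const_int: "rat_const R (of_int z) = of_integer z"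
  by (simp add: rat_const_def of_integer_def)


section \<open>Programs of linear combinations and squares\<close>

lemma (in ring) exec_all_lin_comb:
  assumes "set rs \<subseteq> carrier R" "length rs = N" "0 < N"
    and "\<And>i. i < k \<Longrightarrow> r i < N" "\<And>i. i < k \<Longrightarrow> rat_const R (q i) \<in> carrier R"
  shows "\<exists>ss. exec_all R c rs (lin_comb N q r k) = rs @ ss \<and> length ss = 2 * k + 1 \<and>
           set ss \<subseteq> carrier R \<and> ss ! (2 * k) = (\<Oplus>i\<in>{..<k}. rat_const R (q i) \<otimes> rs ! r i)"
  using assms(4,5)
proof (induction k)
  case 0
  have "rs ! 0 \<in> carrier R" using assms(1-3) by auto
  then have "exec R c rs (Scale 0 0) = \<zero>"
    using rat_const_int[of 0] by simp
  then show ?case by (auto simp: finsum_zero)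
next
  case (Suc k)
  then obtain ss where ss: "exec_all R c rs (lin_comb N q r k) = rs @ ss" "length ss = 2 * k + 1"
    "set ss \<subseteq> carrier R" "ss ! (2 * k) = (\<Oplus>i\<in>{..<k}. rat_const R (q i) \<otimes> rs ! r i)"
    by (auto simp: less_Suc_eq)
  define y where "y = rat_const R (q k) \<otimes> rs ! r k"
  have tm: "rat_const R (q i) \<otimes> rs ! r i \<in> carrier R" if "i \<le> k" for i
    using that Suc.prems assms(1,2) by (intro m_closed) (auto simp: less_Suc_eq_le)
  then have y: "y \<in> carrier R" by (simp add: y_def)
  have last: "ss ! (2 * k) \<in> carrier R"
    using ss(2,3) nth_mem[of "2 * k" ss] by auto
  have "exec_all R c rs (lin_comb N q r (Suc k)) = rs @ ss @ [y, ss ! (2 * k) \<oplus> y]"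
    using Suc.prems assms(2) ss(1,2) by (simp add: nth_append y_def)
  moreover have "ss ! (2 * k) \<oplus> y = (\<Oplus>i\<in>{..<Suc k}. rat_const R (q i) \<otimes> rs ! r i)"
    using tm by (subst finsum_lessThan_Suc) (auto simp: ss(4) y_def)
  moreover have "ss ! (2 * k) \<oplus> y \<in> carrier R" using last y by simp
  ultimately show ?case
    using ss(2,3) y by (intro exI[of _ "ss @ [y, ss ! (2 * k) \<oplus> y]"])
      (simp add: nth_append del: lin_comb.simps)
qed

lemma (in ring) exec_all_lin_combs:
  assumes "set rs \<subseteq> carrier R" "length rs = N" "0 < N" "\<And>i. i < k \<Longrightarrow> r i < N"
    and "\<And>j i. j < n \<Longrightarrow> i < k \<Longrightarrow> rat_const R (q j i) \<in> carrier R"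
  shows "\<exists>ss. exec_all R c rs (lin_combs N q r k n) = rs @ ss \<and> length ss = (2 * k + 1) * n \<and>
           set ss \<subseteq> carrier R \<and>
           (\<forall>j < n. ss ! ((2 * k + 1) * j + 2 * k) = (\<Oplus>i\<in>{..<k}. rat_const R (q j i) \<otimes> rs ! r i))"
  using assms(5)
proof (induction n)
  case (Suc n)
  obtain ss where ss: "exec_all R c rs (lin_combs N q r k n) = rs @ ss"
    "length ss = (2 * k + 1) * n" "set ss \<subseteq> carrier R"
    "\<forall>j < n. ss ! ((2 * k + 1) * j + 2 * k) = (\<Oplus>i\<in>{..<k}. rat_const R (q j i) \<otimes> rs ! r i)"
    using Suc.IH[OF Suc.prems[OF less_SucI]] by blast
  have "\<exists>ts. exec_all R c (rs @ ss) (lin_comb (N + (2 * k + 1) * n) (q n) r k) = (rs @ ss) @ ts \<and>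
      length ts = 2 * k + 1 \<and> set ts \<subseteq> carrier R \<and>
      ts ! (2 * k) = (\<Oplus>i\<in>{..<k}. rat_const R (q n i) \<otimes> (rs @ ss) ! r i)"
    using assms Suc.prems ss(2,3) by (intro exec_all_lin_comb) (auto intro: trans_less_add1)
  then obtain ts where ts:
    "exec_all R c (rs @ ss) (lin_comb (N + (2 * k + 1) * n) (q n) r k) = (rs @ ss) @ ts"
    "length ts = 2 * k + 1" "set ts \<subseteq> carrier R"
    "ts ! (2 * k) = (\<Oplus>i\<in>{..<k}. rat_const R (q n i) \<otimes> (rs @ ss) ! r i)" by blast
  have "rat_const R (q n i) \<otimes> (rs @ ss) ! r i = rat_const R (q n i) \<otimes> rs ! r i" if "i < k" for i
    using that assms(2,4) by (simp add: nth_append)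
  moreover have "rat_const R (q n i) \<otimes> rs ! r i \<in> carrier R" if "i < k" for i
    using that assms(1,2,4) Suc.prems by (intro m_closed) auto
  ultimately have val: "ts ! (2 * k) = (\<Oplus>i\<in>{..<k}. rat_const R (q n i) \<otimes> rs ! r i)"
    unfolding ts(4) by (intro finsum_cong') auto
  have "(ss @ ts) ! ((2 * k + 1) * j + 2 * k) = (\<Oplus>i\<in>{..<k}. rat_const R (q j i) \<otimes> rs ! r i)"
    if "j < Suc n" for j
  proof (cases "j = n")
    case True
    then show ?thesis using val ss(2) by (simp add: nth_append)
  next
    case False
    with that have "j < n" by simp
    have "(2 * k + 1) * j + 2 * k < (2 * k + 1) * Suc j" by simp
    also have "\<dots> \<le> (2 * k + 1) * n" using \<open>j < n\<close> by (intro mult_le_mono2) simp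
    finally show ?thesis using ss(2,4) \<open>j < n\<close> by (simp only: nth_append if_True)
  qed
  moreover have "exec_all R c rs (lin_combs N q r k (Suc n)) = rs @ ss @ ts"
    using ss(1) ts(1) by simp
  ultimately show ?case
    using ss(2,3) ts(2,3) by (intro exI[of _ "ss @ ts"]) (simp del: lin_combs.simps)
qed simp

text \<open>The program that squares \<open>S\<close> linear forms in the 15 inputs, with coefficients \<open>a\<close>, and
  outputs 15 linear combinations of these squares, with coefficients \<open>b\<close>. Each linear form takes
  31 registers, the last of which holds its value.\<close>

definition quad_prog :: "nat \<Rightarrow> (nat \<Rightarrow> nat \<Rightarrow> rat) \<Rightarrow> (nat \<Rightarrow> nat \<Rightarrow> rat) \<Rightarrow> slp" where
  "quad_prog S a b =
     (lin_combs 15 a (\<lambda>i. i) 15 S @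
      map (\<lambda>s. Square (45 + 31 * s)) [0..<S] @
      lin_combs (15 + 32 * S) b (\<lambda>s. 15 + 31 * S + s) S 15,
      map (\<lambda>m. 15 + 32 * S + (2 * S + 1) * m + 2 * S) [0..<15])"

lemma snd_quad_prog:
  "snd (quad_prog S a b) = map (\<lambda>m. 15 + 32 * S + (2 * S + 1) * m + 2 * S) [0..<15]"
  by (simp add: quad_prog_def)

lemma wf_quad_prog: "wf_slp (quad_prog S a b)"
proof -
  have "wf_from 15 (lin_combs 15 a (\<lambda>i. i) 15 S)"
    by (intro wf_lin_combs) auto
  moreover have "wf_from (15 + 31 * S) (map (\<lambda>s. Square (45 + 31 * s)) [0..<S])"
    by (intro wf_from_independent) auto
  moreover have "wf_from (15 + 32 * S) (lin_combs (15 + 32 * S) b (\<lambda>s. 15 + 31 * S + s) S 15)"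
    by (intro wf_lin_combs) auto
  ultimately have "wf_from 15 (fst (quad_prog S a b))"
    by (simp add: quad_prog_def add.commute)
  moreover have "15 + 32 * S + (2 * S + 1) * m + 2 * S < 15 + length (fst (quad_prog S a b))"
    if "m < 15" for m
  proof -
    have "(2 * S + 1) * m + 2 * S < (2 * S + 1) * Suc m" by simp
    also have "\<dots> \<le> (2 * S + 1) * 15" using that by (intro mult_le_mono2) simp
    finally show ?thesis by (simp add: quad_prog_def)
  qed
  ultimately show ?thesis
    by (auto simp: wf_slp_def snd_quad_prog simp flip: wf_from_def)
qed

lemma num_mults_quad_prog: "num_mults (quad_prog S a b) = 0"
  by (simp add: num_mults_def quad_prog_def)

lemma num_squares_quad_prog: "num_squares (quad_prog S a b) = S"
  by (simp add: num_squares_def quad_prog_def)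

lemma quad_prog_Scale:
  "Scale q i \<in> set (fst (quad_prog S a b)) \<Longrightarrow>
     q = 0 \<or> (\<exists>s < S. \<exists>m < 15. q = a s m \<or> q = b m s)"
  by (auto simp: quad_prog_def dest!: set_lin_combs_Scale)

lemma (in ring) run_quad_prog:
  assumes "set xs \<subseteq> carrier R" "length xs = 15"
    and a: "\<And>s m. s < S \<Longrightarrow> m < 15 \<Longrightarrow> rat_const R (a s m) \<in> carrier R"
    and b: "\<And>s m. s < S \<Longrightarrow> m < 15 \<Longrightarrow> rat_const R (b m s) \<in> carrier R"
  shows "run R c (quad_prog S a b) xs =
    map (\<lambda>m. \<Oplus>s\<in>{..<S}. rat_const R (b m s) \<otimes>
                (\<Oplus>i\<in>{..<15}. rat_const R (a s i) \<otimes> xs ! i) [^] (2::nat)) [0..<15]"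
proof -
  define form where "form s = (\<Oplus>i\<in>{..<15}. rat_const R (a s i) \<otimes> xs ! i)" for s
  have xs: "xs ! i \<in> carrier R" if "i < 15" for i
    using that assms(1,2) by auto
  have form: "form s \<in> carrier R" if "s < S" for s
    using that a xs by (auto simp: form_def intro!: finsum_closed)
  have "\<exists>ss. exec_all R c xs (lin_combs 15 a (\<lambda>i. i) 15 S) = xs @ ss \<and>
      length ss = (2 * 15 + 1) * S \<and> set ss \<subseteq> carrier R \<and>
      (\<forall>j < S. ss ! ((2 * 15 + 1) * j + 2 * 15) = (\<Oplus>i\<in>{..<15}. rat_const R (a j i) \<otimes> xs ! i))"
    using assms by (intro exec_all_lin_combs) auto
  then obtain ss where ss: "exec_all R c xs (lin_combs 15 a (\<lambda>i. i) 15 S) = xs @ ss"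
    "length ss = 31 * S" "set ss \<subseteq> carrier R" "\<forall>j < S. ss ! (31 * j + 30) = form j"
    by (auto simp: form_def)
  define sq where "sq = map (\<lambda>s. form s \<otimes> form s) [0..<S]"
  have "(xs @ ss) ! (45 + 31 * s) = form s" if "s < S" for s
    using that ss(4) assms(2) by (simp add: nth_append add.commute)
  then have "exec_all R c (xs @ ss) (map (\<lambda>s. Square (45 + 31 * s)) [0..<S]) = xs @ ss @ sq"
    using ss(2) assms(2) by (subst exec_all_independent) (auto simp: sq_def)
  moreover have "\<exists>ts. exec_all R c (xs @ ss @ sq) (lin_combs (15 + 32 * S) b (\<lambda>s. 15 + 31 * S + s) S 15)
       = (xs @ ss @ sq) @ ts \<and> length ts = (2 * S + 1) * 15 \<and> set ts \<subseteq> carrier R \<and>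
      (\<forall>m < 15. ts ! ((2 * S + 1) * m + 2 * S) =
         (\<Oplus>s\<in>{..<S}. rat_const R (b m s) \<otimes> (xs @ ss @ sq) ! (15 + 31 * S + s)))"
    using assms ss form by (intro exec_all_lin_combs) (auto simp: sq_def)
  then obtain ts where ts:
    "exec_all R c (xs @ ss @ sq) (lin_combs (15 + 32 * S) b (\<lambda>s. 15 + 31 * S + s) S 15)
       = xs @ ss @ sq @ ts"
    "\<forall>m < 15. ts ! ((2 * S + 1) * m + 2 * S) =
         (\<Oplus>s\<in>{..<S}. rat_const R (b m s) \<otimes> (xs @ ss @ sq) ! (15 + 31 * S + s))" by auto
  ultimately have run: "run R c (quad_prog S a b) xs =
      map (\<lambda>m. (xs @ ss @ sq @ ts) ! (15 + 32 * S + (2 * S + 1) * m + 2 * S)) [0..<15]"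
    using ss(1) by (simp add: run_def quad_prog_def)
  have "(xs @ ss @ sq @ ts) ! (15 + 32 * S + (2 * S + 1) * m + 2 * S) =
      (\<Oplus>s\<in>{..<S}. rat_const R (b m s) \<otimes> form s [^] (2::nat))" if m: "m < 15" for m
  proof -
    have "(xs @ ss @ sq @ ts) ! (15 + 32 * S + (2 * S + 1) * m + 2 * S) =
        ts ! ((2 * S + 1) * m + 2 * S)"
      using assms(2) ss(2) by (simp add: nth_append sq_def add.commute)
    also have "\<dots> = (\<Oplus>s\<in>{..<S}. rat_const R (b m s) \<otimes> (xs @ ss @ sq) ! (15 + 31 * S + s))"
      using ts(2) m by blast
    also have "\<dots> = (\<Oplus>s\<in>{..<S}. rat_const R (b m s) \<otimes> form s [^] (2::nat))"
      using assms(2) ss(2) form b m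
      by (intro finsum_cong') (auto simp: nth_append sq_def numeral_2_eq_2)
    finally show ?thesis .
  qed
  then show ?thesis by (simp add: run form_def)
qed


section \<open>The Frobenius endomorphism\<close>

lemma (in cring) binomial:
  assumes x: "x \<in> carrier R" and y: "y \<in> carrier R"
  shows "(x \<oplus> y) [^] n =
    (\<Oplus>k\<in>{..n}. of_integer (int (n choose k)) \<otimes> (x [^] k \<otimes> y [^] (n - k)))"
proof (induction n)
  case 0
  then show ?case using x y by simp
next
  case (Suc n)
  let ?t = "\<lambda>c k. of_integer (int c) \<otimes> (x [^] k \<otimes> y [^] (Suc n - k))"
  have t: "?t c k \<in> carrier R" for c k using x y by simp
  have "(x \<oplus> y) [^] Suc n = (x \<oplus> y) [^] n \<otimes> x \<oplus> (x \<oplus> y) [^] n \<otimes> y"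
    using x y by (simp add: r_distr)
  also have "(x \<oplus> y) [^] n \<otimes> x = (\<Oplus>k\<in>{..n}. ?t (n choose k) (Suc k))"
    unfolding Suc.IH using x y
    by (subst finsum_ldistr) (auto intro!: finsum_cong' simp: m_ac)
  also have "\<dots> = (\<Oplus>k\<in>{..Suc n}. ?t (if k = 0 then 0 else n choose (k - 1)) k)"
    using t by (subst finsum_Suc2) (auto simp: finsum_closed x y)
  also have "(x \<oplus> y) [^] n \<otimes> y = (\<Oplus>k\<in>{..n}. ?t (n choose k) k)"
    unfolding Suc.IH using x y
    by (subst finsum_ldistr) (auto intro!: finsum_cong' simp: m_ac Suc_diff_le)
  also have "\<dots> = (\<Oplus>k\<in>{..Suc n}. ?t (n choose k) k)"
    using t by (subst finsum_Suc) (auto simp: finsum_closed x y binomial_eq_0)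
  also have "(\<Oplus>k\<in>{..Suc n}. ?t (if k = 0 then 0 else n choose (k - 1)) k) \<oplus> \<dots> =
      (\<Oplus>k\<in>{..Suc n}. ?t (if k = 0 then 0 else n choose (k - 1)) k \<oplus> ?t (n choose k) k)"
    using t by (intro finsum_addf[symmetric]) auto
  also have "\<dots> = (\<Oplus>k\<in>{..Suc n}. ?t (Suc n choose k) k)"
  proof (rule finsum_cong')
    fix k
    have "?t a k \<oplus> ?t b k = ?t (a + b) k" for a b
      using x y by (simp add: of_integer_add l_distr)
    moreover have "(if k = 0 then 0 else n choose (k - 1)) + (n choose k) = Suc n choose k"
      by (cases k) auto
    ultimately show "?t (if k = 0 then 0 else n choose (k - 1)) k \<oplus> ?t (n choose k) k =
        ?t (Suc n choose k) k"
      by metis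
  qed (use x y in auto)
  finally show ?case .
qed

lemma (in cring) add_pow_prime:
  assumes p: "Factorial_Ring.prime (p::nat)" and char: "of_integer (int p) = \<zero>"
    and x: "x \<in> carrier R" and y: "y \<in> carrier R"
  shows "(x \<oplus> y) [^] p = x [^] p \<oplus> y [^] p"
proof -
  let ?t = "\<lambda>k. of_integer (int (p choose k)) \<otimes> (x [^] k \<otimes> y [^] (p - k))"
  have t: "?t k \<in> carrier R" for k using x y by simp
  have "p > 1" using p by (rule prime_gt_1_nat)
  then obtain q where q: "p = Suc (Suc q)"
    by (metis less_imp_Suc_add plus_1_eq_Suc)
  have mid: "?t (Suc k) = \<zero>" if k: "k \<le> q" for k
  proof -
    have "p dvd p choose Suc k" using k q p by (intro dvd_choose_prime) auto
    then obtain m where "p choose Suc k = p * m" by (auto elim: dvdE)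
    then have "of_integer (int (p choose Suc k)) = \<zero>"
      using char by (simp add: of_integer_mult)
    then show ?thesis using x y by simp
  qed
  have "(x \<oplus> y) [^] p = (\<Oplus>k\<in>{..Suc (Suc q)}. ?t k)"
    using binomial[OF x y, of p] q by simp
  also have "\<dots> = (\<Oplus>k\<in>{..Suc q}. ?t (Suc k)) \<oplus> ?t 0"
    using t by (intro finsum_Suc2) (auto simp: x y simp del: nat_pow_Suc)
  also have "(\<Oplus>k\<in>{..Suc q}. ?t (Suc k)) = ?t (Suc (Suc q)) \<oplus> (\<Oplus>k\<in>{..q}. ?t (Suc k))"
    using t by (intro finsum_Suc) (auto simp: x y simp del: nat_pow_Suc)
  also have "(\<Oplus>k\<in>{..q}. ?t (Suc k)) = (\<Oplus>k\<in>{..q}. \<zero>)"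
    using mid by (intro finsum_cong') (auto simp: x y simp del: nat_pow_Suc)
  finally show ?thesis using x y q by (simp add: finsum_zero)
qed

lemma (in ring) frobenius_0: "x \<in> carrier R \<Longrightarrow> frobenius 0 p R x = x"
  by (simp add: frobenius_def)

lemma (in ring) frobenius_Suc:
  "x \<in> carrier R \<Longrightarrow> frobenius (Suc i) p R x = frobenius i p R x [^] p"
  by (simp add: frobenius_def nat_pow_pow mult.commute)

lemma (in cring) finsum_frobenius:
  assumes "Factorial_Ring.prime (p::nat)" "of_integer (int p) = \<zero>"
    and "finite A" "\<And>m. m \<in> A \<Longrightarrow> f m \<in> carrier R"
  shows "frobenius i p R (\<Oplus>m\<in>A. f m) = (\<Oplus>m\<in>A. frobenius i p R (f m))"
proof -
  have add: "frobenius i p R (x \<oplus> y) = frobenius i p R x \<oplus> frobenius i p R y"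
    if "x \<in> carrier R" "y \<in> carrier R" for x y
  proof (induction i)
    case 0
    then show ?case using that by (simp add: frobenius_0)
  next
    case (Suc i)
    show ?case using that Suc assms(1,2)
      by (simp add: frobenius_Suc) (simp add: frobenius_def add_pow_prime)
  qed
  have zero: "frobenius i p R \<zero> = \<zero>"
    using prime_gt_0_nat[OF assms(1)] by (simp add: frobenius_def nat_pow_zero)
  have closed: "x \<in> carrier R \<Longrightarrow> frobenius i p R x \<in> carrier R" for x
    by (simp add: frobenius_def)
  show ?thesis
    using assms(3,4)
  proof (induction A rule: finite_induct)
    case empty
    then show ?case by (simp add: finsum_zero zero)
  next
    case (insert a A)
    then show ?case
      using closed by (simp add: finsum_insert Pi_def add finsum_closed)
  qed
qed

lemma (in ring) combine_snoc:
  assumes "length Ks = length Us" "set (k # Ks) \<subseteq> carrier R" "set (u # Us) \<subseteq> carrier R"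
  shows "combine (Ks @ [k]) (Us @ [u]) = combine Ks Us \<oplus> k \<otimes> u"
  using assms by (induction Ks Us rule: list_induct2) (auto simp: a_assoc)

lemma (in ring) combine_map_upt:
  assumes "\<And>i. g i \<in> carrier R" "set xs \<subseteq> carrier R"
  shows "combine xs (map g [0..<length xs]) = (\<Oplus>i\<in>{..<length xs}. xs ! i \<otimes> g i)"
  using assms(2)
proof (induction xs rule: rev_induct)
  case Nil
  then show ?case by (simp add: finsum_zero)
next
  case (snoc x xs)
  have xs: "xs ! i \<in> carrier R" if "i < length xs" for i
    using that snoc.prems by (auto dest: nth_mem)
  have "combine (xs @ [x]) (map g [0..<length (xs @ [x])]) =
      (\<Oplus>i\<in>{..<length xs}. xs ! i \<otimes> g i) \<oplus> x \<otimes> g (length xs)"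
    using snoc assms(1) by (simp add: combine_snoc image_subset_iff)
  also have "(\<Oplus>i\<in>{..<length xs}. xs ! i \<otimes> g i) = (\<Oplus>i\<in>{..<length xs}. (xs @ [x]) ! i \<otimes> g i)"
    using xs assms(1) by (intro finsum_cong') (auto simp: nth_append)
  also have "\<dots> \<oplus> x \<otimes> g (length xs) = (\<Oplus>i\<in>{..<Suc (length xs)}. (xs @ [x]) ! i \<otimes> g i)"
    using xs assms(1) snoc.prems
    by (subst finsum_lessThan_Suc) (force simp: nth_append less_Suc_eq_le le_less)+
  finally show ?case by simp
qed


section \<open>Roots of unity in the tower\<close>

context tower15
begin

lemma subring_K: "subring K L"
  by (rule subfieldE(1)[OF subfield_K])

lemma K_carrier: "x \<in> K \<Longrightarrow> x \<in> carrier L"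
  using subfieldE(3)[OF subfield_K] by blast

lemma finite_K: "finite K"
  using card_K p_gt_3 by (metis card.infinite not_less_zero)

text \<open>The field has characteristic \<open>p\<close>, since the additive group of \<open>K\<close> has order \<open>p\<close>.\<close>

lemma of_integer_p: "of_integer (int p) = \<zero>"
proof -
  interpret K: field "L\<lparr>carrier := K\<rparr>"
    by (rule subfield_iff(2)[OF subfield_K])
  have "\<one> [^]\<^bsub>add_monoid (L\<lparr>carrier := K\<rparr>)\<^esub> order (add_monoid (L\<lparr>carrier := K\<rparr>)) =
      \<one>\<^bsub>add_monoid (L\<lparr>carrier := K\<rparr>)\<^esub>"
    using subringE(3)[OF subring_K] by (intro group.pow_order_eq_1[OF K.a_group]) simp
  then show ?thesis
    by (simp add: order_def card_K of_integer_nat add_pow_def nat_pow_def)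
qed

lemma of_integer_eq_0_iff: "of_integer z = \<zero> \<longleftrightarrow> int p dvd z"
proof
  assume z: "of_integer z = \<zero>"
  show "int p dvd z"
  proof (rule ccontr)
    assume "\<not> int p dvd z"
    then have "coprime (int p) z"
      using p_prime by (simp add: prime_imp_coprime)
    then obtain a b where "a * int p + b * z = 1"
      by (metis bezout_int coprime_iff_gcd_eq_1)
    then have "of_integer a \<otimes> of_integer (int p) \<oplus> of_integer b \<otimes> of_integer z = \<one>"
      by (metis of_integer_1 of_integer_add of_integer_mult)
    with z of_integer_p show False by simp
  qed
next
  assume "int p dvd z"
  then show "of_integer z = \<zero>" using of_integer_p by (auto simp: of_integer_mult)
qed

lemma pow_mult_of_K:
  "x [^]\<^bsub>Multiplicative_Group.mult_of (L\<lparr>carrier := K\<rparr>)\<^esub> n = x [^] (n::nat)"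
  by (simp add: nat_pow_def)

lemma K_pow_card:
  assumes "x \<in> K" "x \<noteq> \<zero>"
  shows "x [^] (p - 1) = \<one>"
proof -
  interpret K: field "L\<lparr>carrier := K\<rparr>"
    by (rule subfield_iff(2)[OF subfield_K])
  have "x [^]\<^bsub>Multiplicative_Group.mult_of (L\<lparr>carrier := K\<rparr>)\<^esub>
      order (Multiplicative_Group.mult_of (L\<lparr>carrier := K\<rparr>)) =
      \<one>\<^bsub>Multiplicative_Group.mult_of (L\<lparr>carrier := K\<rparr>)\<^esub>"
    using assms by (intro group.pow_order_eq_1[OF K.field_mult_group]) simp
  moreover have "order (Multiplicative_Group.mult_of (L\<lparr>carrier := K\<rparr>)) = p - 1"
    using finite_K by (subst K.order_mult_of) (simp_all add: order_def card_K)
  ultimately show ?thesis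
    by (simp add: pow_mult_of_K)
qed

lemma K_pow_p: "x \<in> K \<Longrightarrow> x [^] p = x"
proof -
  assume x: "x \<in> K"
  have "x [^] p = x [^] (p - 1) \<otimes> x"
    using p_gt_3 by (cases p) auto
  with K_pow_card[OF x] x K_carrier[OF x] show ?thesis
    by (cases "x = \<zero>") auto
qed

lemma frobenius_K: "x \<in> K \<Longrightarrow> frobenius i p L x = x"
proof (induction i)
  case (Suc i)
  then show ?case by (simp add: frobenius_Suc K_carrier K_pow_p)
qed (simp add: frobenius_0 K_carrier)

lemma p_neq_7: "p \<noteq> 7"
  using p_cong by (auto simp: cong_def)

lemma seven_nonzero: "of_integer 7 \<noteq> \<zero>"
proof
  assume "of_integer 7 = \<zero>"
  then have "int p dvd int 7" by (simp add: of_integer_eq_0_iff)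
  then have "p dvd 7" by (simp only: int_dvd_int_iff)
  moreover have "Factorial_Ring.prime (7::nat)" by simp
  ultimately show False
    using p_neq_7 p_prime primes_dvd_imp_eq by blast
qed

lemma u_pow5: "u [^] (5::nat) = of_integer 7"
  using u_pow of_integer_nat[of 7] by simp

lemma v_pow15: "v [^] (15::nat) = of_integer 7"
  using v_pow u_pow5 v_carrier nat_pow_pow[of v 3 5] by simp

text \<open>A cube root \<open>w\<close> would split off the factor \<open>X - w\<close> of \<open>X\<^sup>3 - u\<close>.\<close>

lemma u_not_cube:
  assumes w: "w \<in> simple_extension K u"
  shows "w [^] (3::nat) \<noteq> u"
proof
  assume wu: "w [^] (3::nat) = u"
  let ?F = "simple_extension K u"
  have F: "subring ?F L"
    by (rule simple_extension_is_subring[OF subring_K u_carrier])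
  note F' = subringE[OF F]
  have uF: "u \<in> ?F" by (rule simple_extension_mem[OF subring_K u_carrier])
  have wL: "w \<in> carrier L" using w F'(1) by blast
  have nz: "\<one> \<noteq> \<zero>" by simp
  have carr: "[\<one>, \<ominus> w] \<in> carrier (?F[X])" "[\<one>, w, w \<otimes> w] \<in> carrier (?F[X])"
    "[\<one>, \<zero>, \<zero>, \<ominus> u] \<in> carrier (?F[X])"
    using F' w uF nz by (auto simp: polynomial_def simp flip: univ_poly_carrier)
  have "poly_mult [\<one>, \<ominus> w] [\<one>, w, w \<otimes> w] = [\<one>, \<zero>, \<zero>, \<ominus> u]"
    using wL u_carrier wu[symmetric] by (auto simp: l_minus r_neg l_neg numeral_3_eq_3 m_assoc)
  then have "[\<one>, \<zero>, \<zero>, \<ominus> u] = [\<one>, \<ominus> w] \<otimes>\<^bsub>?F[X]\<^esub> [\<one>, w, w \<otimes> w]"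
    by (simp add: univ_poly_mult del: poly_mult.simps)
  then have "[\<one>, \<ominus> w] \<in> Units (?F[X]) \<or> [\<one>, w, w \<otimes> w] \<in> Units (?F[X])"
    using carr by (intro pirreducibleE(3)[OF F _ irreducible_v])
  then show False
    using univ_poly_units_incl[OF F] by blast
qed

text \<open>If \<open>p\<close> were \<open>2\<close> modulo 3, then \<open>u\<close>, whose order divides \<open>N = 5 (p - 1)\<close>, would be the
  cube of a power of itself, because 3 divides \<open>N + 1\<close>.\<close>

lemma three_dvd: "3 dvd p - 1"
proof (rule ccontr)
  assume not1: "\<not> 3 dvd p - 1"
  have "Factorial_Ring.prime (3::nat)" by simp
  then have "\<not> 3 dvd p"
    using p_prime p_gt_3 primes_dvd_imp_eq[of 3 p] by auto
  then have "3 dvd 5 * (p - 1) + 1"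
    using not1 p_gt_3 by presburger
  then obtain k where k: "5 * (p - 1) + 1 = 3 * k" by (auto elim: dvdE)
  have "u [^] (5 * (p - 1)) = \<one>"
    using K_pow_card[of "of_integer 7"] seven_nonzero of_integer_in_subring[OF subring_K] u_carrier
    by (simp add: u_pow5 flip: nat_pow_pow)
  then have "u [^] (3 * k) = u"
    using u_carrier by (simp flip: k)
  then have "(u [^] k) [^] (3::nat) = u"
    using u_carrier by (simp add: nat_pow_pow mult.commute)
  moreover have "u [^] k \<in> simple_extension K u"
  proof -
    note F = simple_extension_is_subring[OF subring_K u_carrier]
    show ?thesis
      by (induction k) (use subringE[OF F] simple_extension_mem[OF subring_K u_carrier] in auto)
  qed
  ultimately show False using u_not_cube by blast
qed

lemma fifteen_dvd: "15 dvd p - 1"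
proof -
  have "5 dvd p - 1"
    using p_cong p_gt_3 unfolding cong_def by presburger
  then show ?thesis using three_dvd by presburger
qed

lemma p_gt_15: "p > 15"
  using fifteen_dvd p_gt_3 by (auto dest: dvd_imp_le)

text \<open>The factor by which the \<open>p\<close>-Frobenius map multiplies \<open>v\<close>. It lies in \<open>K\<close>, where it is a
  15th root of unity, because 15 divides \<open>p - 1\<close> and \<open>v\<^sup>1\<^sup>5 = 7\<close>.\<close>

definition \<zeta> :: 'a where
  "\<zeta> = v [^] (p - 1)"

lemma \<zeta>_eq: "\<zeta> = of_integer 7 [^] ((p - 1) div 15)"
  using fifteen_dvd v_carrier by (simp add: \<zeta>_def nat_pow_pow flip: v_pow15)

lemma pow_in_K: "x \<in> K \<Longrightarrow> x [^] (n::nat) \<in> K"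
  by (induction n) (use subringE[OF subring_K] in auto)

lemma \<zeta>_in_K: "\<zeta> \<in> K"
  by (simp add: \<zeta>_eq pow_in_K of_integer_in_subring[OF subring_K])

lemma \<zeta>_closed [simp]: "\<zeta> \<in> carrier L"
  by (rule K_carrier[OF \<zeta>_in_K])

lemma \<zeta>_pow15: "\<zeta> [^] (15::nat) = \<one>"
proof -
  have "\<zeta> [^] (15::nat) = of_integer 7 [^] (p - 1)"
    using fifteen_dvd by (simp add: \<zeta>_eq nat_pow_pow)
  then show ?thesis
    using K_pow_card[OF of_integer_in_subring[OF subring_K] seven_nonzero] by simp
qed

text \<open>If \<open>\<zeta>\<^sup>5 = 7\<^bsup>(p - 1) / 3\<^esup>\<close> were 1, then \<open>7 = c\<^sup>3\<close> for some \<open>c\<close> in \<open>K\<close>, because the unit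
  group of \<open>K\<close> is cyclic, and \<open>u = u\<^sup>6 / 7 = (u\<^sup>2 / c)\<^sup>3\<close> would be a cube, too.\<close>

lemma \<zeta>_pow5: "\<zeta> [^] (5::nat) \<noteq> \<one>"
proof
  assume 1: "\<zeta> [^] (5::nat) = \<one>"
  interpret K: field "L\<lparr>carrier := K\<rparr>"
    by (rule subfield_iff(2)[OF subfield_K])
  obtain g where g: "g \<in> K" "g \<noteq> \<zero>"
    and gen: "carrier (Multiplicative_Group.mult_of (L\<lparr>carrier := K\<rparr>)) = {g [^] (i::nat) | i. i \<in> UNIV}"
    using K.finite_field_mult_group_has_gen finite_K by (auto simp flip: nat_pow_consistent)
  have K_eq: "K - {\<zero>} = {g [^] (i::nat) | i. i \<in> UNIV}"
    using gen by simp
  have gL: "g \<in> carrier L" using g(1) by (rule K_carrier)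
  interpret G: group "Multiplicative_Group.mult_of (L\<lparr>carrier := K\<rparr>)" by (rule K.field_mult_group)
  have gG: "g \<in> carrier (Multiplicative_Group.mult_of (L\<lparr>carrier := K\<rparr>))" using g by simp
  have "G.ord g = card (K - {\<zero>})"
  proof -
    have "finite (carrier (Multiplicative_Group.mult_of (L\<lparr>carrier := K\<rparr>)))"
      using finite_K by simp
    from G.generate_pow_on_finite_carrier[OF this gG] G.generate_pow_card[OF gG]
    show ?thesis unfolding K_eq pow_mult_of_K by simp
  qed
  then have "G.ord g = p - 1"
    using subringE(2)[OF subring_K] finite_K by (simp add: card_K)
  then have g_ord: "p - 1 dvd n" if "g [^] n = \<one>" for n :: nat
    using G.pow_eq_id[OF gG, of n] that by (simp add: pow_mult_of_K)
  have "of_integer 7 \<in> K - {\<zero>}"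
    using seven_nonzero of_integer_in_subring[OF subring_K] by blast
  then obtain k where k: "of_integer 7 = g [^] (k::nat)" by (auto simp: K_eq)
  define q where "q = (p - 1) div 15"
  have q: "p - 1 = 15 * q" "q > 0" using fifteen_dvd p_gt_3 by (auto simp: q_def)
  have "g [^] (k * (5 * q)) = \<one>"
    using 1 gL by (simp add: \<zeta>_eq k nat_pow_pow q_def mult_ac)
  then have "15 * q dvd k * (5 * q)" using g_ord q(1) by metis
  then have "3 dvd k" using q(2) by auto
  then obtain m where m: "k = 3 * m" by (auto elim: dvdE)
  define c where "c = g [^] m"
  have c: "c \<in> K - {\<zero>}" "of_integer 7 = c [^] (3::nat)"
    using gL k m by (auto simp: c_def K_eq nat_pow_pow mult.commute)
  have cinv: "inv c \<in> K" "c \<otimes> inv c = \<one>"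
    using subfield_m_inv[OF subfield_K c(1)] by auto
  define w where "w = u [^] (2::nat) \<otimes> inv c"
  note F = simple_extension_is_subring[OF subring_K u_carrier]
  have "w \<in> simple_extension K u"
    using cinv(1) simple_extension_mem[OF subring_K u_carrier]
      simple_extension_incl[OF subfieldE(3)[OF subfield_K] u_carrier] subringE(6)[OF F]
    by (auto simp: w_def numeral_2_eq_2 u_carrier)
  moreover have "w [^] (3::nat) = u"
  proof -
    have L: "c \<in> carrier L" "inv c \<in> carrier L" using c cinv K_carrier by auto
    have "w [^] (3::nat) = u [^] (6::nat) \<otimes> inv c [^] (3::nat)"
      using L u_carrier by (simp add: w_def nat_pow_distrib nat_pow_pow)
    also have "u [^] (6::nat) = c [^] (3::nat) \<otimes> u"
      using u_pow5 c(2) u_carrier nat_pow_mult[of u 5 1] by simp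
    also have "\<dots> \<otimes> inv c [^] (3::nat) = u \<otimes> (c \<otimes> inv c) [^] (3::nat)"
      using L u_carrier by (simp add: nat_pow_distrib m_ac)
    finally show ?thesis using cinv u_carrier by simp
  qed
  ultimately show False using u_not_cube by blast
qed

end


section \<open>Cost of the Frobenius maps\<close>

context tower15
begin

lemma tower_basis_eq: "tower_basis L u v = map (\<lambda>m. v [^] m) [0..<15]"
proof -
  have "u [^] i \<otimes> v [^] j = v [^] (3 * i + j)" for i j :: nat
    using v_carrier by (simp add: nat_pow_pow nat_pow_mult flip: v_pow)
  then have "tower_basis L u v = concat (map (\<lambda>i. map (\<lambda>j. v [^] (3 * i + j)) [0..<3]) [0..<5])"
    by (simp add: tower_basis_def)
  moreover have "concat (map (\<lambda>i. map (\<lambda>j. f (3 * i + j)) [0..<3]) [0..<5]) = map f [0..<15]"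
    for f :: "nat \<Rightarrow> 'a"
    by (simp add: upt_rec numeral_eq_Suc)
  ultimately show ?thesis by simp
qed

lemma of_coords_eq:
  assumes "length xs = 15" "set xs \<subseteq> K"
  shows "of_coords L u v xs = (\<Oplus>m\<in>{..<15}. xs ! m \<otimes> v [^] m)"
proof -
  have "set xs \<subseteq> carrier L" using assms(2) K_carrier by blast
  then show ?thesis
    using combine_map_upt[of "\<lambda>m. v [^] m" xs] assms(1) v_carrier
    by (simp add: of_coords_def tower_basis_eq)
qed

lemma frobenius_v: "frobenius i p L v = \<zeta> [^] i \<otimes> v"
proof (induction i)
  case 0
  then show ?case using v_carrier by (simp add: frobenius_0)
next
  case (Suc i)
  have "v [^] p = \<zeta> \<otimes> v"
    using p_gt_3 v_carrier nat_pow_mult[of v "p - 1" 1] by (simp add: \<zeta>_def)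
  then show ?case
    using Suc v_carrier K_pow_p[OF pow_in_K[OF \<zeta>_in_K, of i]]
    by (simp add: frobenius_Suc nat_pow_distrib m_assoc)
qed

lemma frobenius_of_coords:
  assumes "length xs = 15" "set xs \<subseteq> K"
  shows "frobenius i p L (of_coords L u v xs) =
           (\<Oplus>m\<in>{..<15}. (xs ! m \<otimes> \<zeta> [^] (i * m)) \<otimes> v [^] m)"
proof -
  have xs: "xs ! m \<in> K" if "m < 15" for m
    using that assms by auto
  have "frobenius i p L (of_coords L u v xs) =
      (\<Oplus>m\<in>{..<15}. frobenius i p L (xs ! m \<otimes> v [^] m))"
    unfolding of_coords_eq[OF assms] using xs v_carrier K_carrier p_prime of_integer_p
    by (intro finsum_frobenius) auto
  also have "\<dots> = (\<Oplus>m\<in>{..<15}. (xs ! m \<otimes> \<zeta> [^] (i * m)) \<otimes> v [^] m)"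
  proof (rule finsum_cong')
    fix m :: nat assume "m \<in> {..<15}"
    then have m: "xs ! m \<in> K" "xs ! m \<in> carrier L" using xs K_carrier by auto
    have "frobenius i p L (xs ! m \<otimes> v [^] m) = frobenius i p L (xs ! m) \<otimes> frobenius i p L v [^] m"
      using m v_carrier by (simp add: frobenius_def nat_pow_distrib nat_pow_pow mult.commute)
    also have "\<dots> = (xs ! m \<otimes> \<zeta> [^] (i * m)) \<otimes> v [^] m"
      using m v_carrier by (simp add: frobenius_K frobenius_v nat_pow_distrib nat_pow_pow m_assoc)
    finally show "frobenius i p L (xs ! m \<otimes> v [^] m) = (xs ! m \<otimes> \<zeta> [^] (i * m)) \<otimes> v [^] m" .
  qed (use xs K_carrier v_carrier in auto)
  finally show ?thesis .
qed

end

text \<open>Multiplies coordinate \<open>m\<close>, for \<open>m\<close> in \<open>ms\<close>, by the precomputed constant \<open>c m\<close>. The constants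
  occupy the registers from 15 and the products those from 30; \<open>outs\<close> selects the output
  registers.\<close>

definition scaling_prog :: "nat list \<Rightarrow> nat list \<Rightarrow> slp" where
  "scaling_prog ms outs = (map Const [0..<15] @ map (\<lambda>m. Mult m (15 + m)) ms, outs)"

lemma run_scaling_prog:
  assumes "length xs = 15" "set ms \<subseteq> {..<15}"
  shows "run R c (scaling_prog ms outs) xs =
    map ((!) (xs @ map c [0..<15] @ map (\<lambda>m. xs ! m \<otimes>\<^bsub>R\<^esub> c m) ms)) outs"
proof -
  have "exec_all R c xs (map Const [0..<15]) = xs @ map c [0..<15]"
    by (subst exec_all_independent) (auto simp: comp_def)
  moreover have "exec_all R c (xs @ map c [0..<15]) (map (\<lambda>m. Mult m (15 + m)) ms) =
      xs @ map c [0..<15] @ map (\<lambda>m. xs ! m \<otimes>\<^bsub>R\<^esub> c m) ms"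
    using assms by (subst exec_all_independent) (fastforce simp: nth_append)+
  ultimately show ?thesis
    by (simp add: run_def scaling_prog_def)
qed

lemma wf_scaling_prog:
  assumes "set ms \<subseteq> {..<15}" "length outs = 15" "set outs \<subseteq> {..<30 + length ms}"
  shows "wf_slp (scaling_prog ms outs)"
proof -
  have "wf_from 15 (map Const [0..<15])"
    by (intro wf_from_independent) auto
  moreover have "wf_from 30 (map (\<lambda>m. Mult m (15 + m)) ms)"
    using assms(1) by (intro wf_from_independent) fastforce
  ultimately have "wf_from 15 (fst (scaling_prog ms outs))"
    by (simp add: scaling_prog_def)
  then show ?thesis
    using assms by (auto simp: wf_slp_def wf_from_def scaling_prog_def)
qed

text \<open>The hypothesis \<open>scale\<close> says that a coordinate that is passed on unchanged has the factor
  \<open>\<zeta>\<^bsup>i m\<^esup> = 1\<close>, and that the output register of any other coordinate holds its product.\<close>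

lemma costs_frobenius:
  assumes ms: "set ms \<subseteq> {..<15}" "length ms \<le> x"
    and outs: "length outs = 15" "set outs \<subseteq> {..<30 + length ms}"
    and scale: "\<And>m. m < 15 \<Longrightarrow> outs ! m < 15 \<and> outs ! m = m \<and> 15 dvd i * m \<or>
                  outs ! m \<ge> 30 \<and> ms ! (outs ! m - 30) = m"
  shows "costs (\<lambda>p (L :: 'a ring). carrier L) (frobenius i) x 0"
  unfolding costs_def
proof (intro exI[of _ "scaling_prog ms outs"] conjI allI impI)
  show "wf_slp (scaling_prog ms outs)"
    using ms(1) outs by (rule wf_scaling_prog)
  show "num_mults (scaling_prog ms outs) \<le> x" "num_squares (scaling_prog ms outs) \<le> 0"
    using ms(2) by (simp_all add: num_mults_def num_squares_def scaling_prog_def comp_def)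
  fix p K u v and L :: "'a ring"
  assume "tower15 L p K u v"
  then interpret tower15 L p K u v .
  show "rats_defined L (scaling_prog ms outs)"
    by (auto simp: rats_defined_def scaling_prog_def)
  define c where "c m = \<zeta> [^]\<^bsub>L\<^esub> (i * m)" for m
  have c: "c m \<in> K" for m by (simp add: c_def pow_in_K \<zeta>_in_K)
  have "computes L K u v c (scaling_prog ms outs) (carrier L) (frobenius i p L)"
    unfolding computes_def
  proof (intro allI impI)
    fix xs assume xs: "length xs = 15" "set xs \<subseteq> K"
    have "run L c (scaling_prog ms outs) xs ! m = xs ! m \<otimes>\<^bsub>L\<^esub> c m" if m: "m < 15" for m
    proof (cases "outs ! m < 30")
      case True
      with scale[OF m] have "outs ! m = m" "15 dvd i * m" by auto
      from this(2) obtain k where k: "i * m = 15 * k" by (auto elim: dvdE)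
      have "c m = (\<zeta> [^]\<^bsub>L\<^esub> (15::nat)) [^]\<^bsub>L\<^esub> k" by (simp add: c_def nat_pow_pow k)
      then have "c m = \<one>\<^bsub>L\<^esub>" by (simp add: \<zeta>_pow15)
      moreover have "xs ! m \<in> carrier L" using xs m by (intro K_carrier) auto
      ultimately show ?thesis
        using m xs(1) outs(1) \<open>outs ! m = m\<close>
        by (simp add: run_scaling_prog[OF xs(1) ms(1)] nth_append)
    next
      case False
      with scale[OF m] have "ms ! (outs ! m - 30) = m" by auto
      moreover have "outs ! m - 30 < length ms"
      proof -
        have "outs ! m \<in> set outs" using outs(1) m by simp
        with outs(2) have "outs ! m < 30 + length ms" by blast
        with False show ?thesis by simp
      qed
      moreover have "\<not> outs ! m < 15" "\<not> outs ! m - 15 < 15" using False by auto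
      ultimately show ?thesis
        using m xs(1) outs(1) False
        by (simp add: run_scaling_prog[OF xs(1) ms(1)] nth_append)
    qed
    moreover have len: "length (run L c (scaling_prog ms outs) xs) = 15"
      using outs(1) by (simp add: run_scaling_prog[OF xs(1) ms(1)])
    ultimately have run: "run L c (scaling_prog ms outs) xs = map (\<lambda>m. xs ! m \<otimes>\<^bsub>L\<^esub> c m) [0..<15]"
      by (intro nth_equalityI) auto
    have xs_K: "xs ! m \<in> K" if "m < 15" for m
      using that xs by auto
    then have "xs ! m \<otimes>\<^bsub>L\<^esub> c m \<in> K" if "m < 15" for m
      using that c subringE(6)[OF subring_K] by simp
    then have sub: "set (run L c (scaling_prog ms outs) xs) \<subseteq> K"
      by (auto simp: run)
    have "of_coords L u v (run L c (scaling_prog ms outs) xs) =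
        (\<Oplus>\<^bsub>L\<^esub>m\<in>{..<15}. (xs ! m \<otimes>\<^bsub>L\<^esub> \<zeta> [^]\<^bsub>L\<^esub> (i * m)) \<otimes>\<^bsub>L\<^esub> v [^]\<^bsub>L\<^esub> m)"
      unfolding of_coords_eq[OF len sub] using xs_K K_carrier v_carrier
      by (intro finsum_cong') (auto simp: run c_def)
    with sub show "set (run L c (scaling_prog ms outs) xs) \<subseteq> K \<and>
        of_coords L u v (run L c (scaling_prog ms outs) xs) = frobenius i p L (of_coords L u v xs)"
      using frobenius_of_coords[OF xs] by simp
  qed
  with c show "\<exists>c. range c \<subseteq> K \<and> computes L K u v c (scaling_prog ms outs) (carrier L) (frobenius i p L)"
    by blast
qed

lemma costs_frobenius_14: "costs (\<lambda>p (L :: 'a ring). carrier L) (frobenius i) 14 0"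
proof (rule costs_frobenius)
  let ?ms = "[1::nat..<15]" and ?outs = "0 # [30::nat..<44]"
  show "set ?ms \<subseteq> {..<15}" "length ?ms \<le> 14" "length ?outs = 15" "set ?outs \<subseteq> {..<30 + length ?ms}"
    by auto
  show "?outs ! m < 15 \<and> ?outs ! m = m \<and> 15 dvd i * m \<or> ?outs ! m \<ge> 30 \<and> ?ms ! (?outs ! m - 30) = m"
    if "m < 15" for m
    using that by (cases "m = 0") (auto simp: nth_Cons')
qed

lemma costs_frobenius_10:
  assumes "5 dvd i"
  shows "costs (\<lambda>p (L :: 'a ring). carrier L) (frobenius i) 10 0"
proof (rule costs_frobenius)
  let ?ms = "[1::nat, 2, 4, 5, 7, 8, 10, 11, 13, 14]"
  let ?outs = "[0::nat, 30, 31, 3, 32, 33, 6, 34, 35, 9, 36, 37, 12, 38, 39]"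
  show "set ?ms \<subseteq> {..<15}" "length ?ms \<le> 10" "length ?outs = 15" "set ?outs \<subseteq> {..<30 + length ?ms}"
    by auto
  have *: "15 dvd i * m" if "3 dvd m" for m
    using mult_dvd_mono[OF assms that] by simp
  show "?outs ! m < 15 \<and> ?outs ! m = m \<and> 15 dvd i * m \<or> ?outs ! m \<ge> 30 \<and> ?ms ! (?outs ! m - 30) = m"
    if "m < 15" for m
  proof -
    have "{..<15::nat} = {0, 1, 2, 3, 4, 5, 6, 7, 8, 9, 10, 11, 12, 13, 14}"
      by (auto simp: lessThan_nat_numeral lessThan_Suc)
    with that have "m \<in> {0, 1, 2, 3, 4, 5, 6, 7, 8, 9, 10, 11, 12, 13, 14}" by blast
    then show ?thesis
      by (elim insertE emptyE) (simp_all add: *)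
  qed
qed


section \<open>Squaring by interpolation\<close>

lemma (in ring) finsum_mult:
  assumes "finite A" "finite B" and f: "\<And>i. i \<in> A \<Longrightarrow> f i \<in> carrier R"
    and g: "\<And>j. j \<in> B \<Longrightarrow> g j \<in> carrier R"
  shows "(\<Oplus>i\<in>A. f i) \<otimes> (\<Oplus>j\<in>B. g j) = (\<Oplus>i\<in>A. \<Oplus>j\<in>B. f i \<otimes> g j)"
proof -
  have "(\<Oplus>i\<in>A. f i) \<otimes> (\<Oplus>j\<in>B. g j) = (\<Oplus>i\<in>A. f i \<otimes> (\<Oplus>j\<in>B. g j))"
    using assms by (intro finsum_ldistr) (auto intro!: finsum_closed)
  also have "\<dots> = (\<Oplus>i\<in>A. \<Oplus>j\<in>B. f i \<otimes> g j)"
  proof (rule finsum_cong')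
    fix i assume "i \<in> A"
    then show "f i \<otimes> (\<Oplus>j\<in>B. g j) = (\<Oplus>j\<in>B. f i \<otimes> g j)"
      using assms by (intro finsum_rdistr) auto
  qed (use f g in \<open>auto intro!: finsum_closed\<close>)
  finally show ?thesis .
qed

lemma (in cring) finsum_square:
  fixes N :: nat
  assumes T: "T \<in> carrier R" and b: "\<And>k. k < N \<Longrightarrow> b k \<in> carrier R"
  shows "(\<Oplus>k\<in>{..<N}. b k \<otimes> T [^] k) [^] (2::nat) =
    (\<Oplus>k\<in>{..<N}. \<Oplus>l\<in>{..<N}. (b k \<otimes> b l) \<otimes> T [^] (k + l))"
proof -
  have "(\<Oplus>k\<in>{..<N}. b k \<otimes> T [^] k) \<otimes> (\<Oplus>l\<in>{..<N}. b l \<otimes> T [^] l) =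
      (\<Oplus>k\<in>{..<N}. \<Oplus>l\<in>{..<N}. (b k \<otimes> T [^] k) \<otimes> (b l \<otimes> T [^] l))"
    using T b by (intro finsum_mult) auto
  also have "\<dots> = (\<Oplus>k\<in>{..<N}. \<Oplus>l\<in>{..<N}. (b k \<otimes> b l) \<otimes> T [^] (k + l))"
    using T b by (intro finsum_cong') (auto intro!: finsum_closed
        simp: m_ac simp flip: nat_pow_mult)
  finally show ?thesis using T b by (simp add: numeral_2_eq_2 finsum_closed)
qed

lemma (in ring) finsum_rdistr2:
  assumes "finite A" "finite B" "a \<in> carrier R"
    and "\<And>i j. i \<in> A \<Longrightarrow> j \<in> B \<Longrightarrow> f i j \<in> carrier R"
  shows "a \<otimes> (\<Oplus>i\<in>A. \<Oplus>j\<in>B. f i j) = (\<Oplus>i\<in>A. \<Oplus>j\<in>B. a \<otimes> f i j)"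
proof -
  have "a \<otimes> (\<Oplus>i\<in>A. \<Oplus>j\<in>B. f i j) = (\<Oplus>i\<in>A. a \<otimes> (\<Oplus>j\<in>B. f i j))"
    using assms by (intro finsum_rdistr) (auto intro!: finsum_closed)
  also have "\<dots> = (\<Oplus>i\<in>A. \<Oplus>j\<in>B. a \<otimes> f i j)"
  proof (rule finsum_cong')
    fix i assume "i \<in> A"
    then show "a \<otimes> (\<Oplus>j\<in>B. f i j) = (\<Oplus>j\<in>B. a \<otimes> f i j)"
      using assms by (intro finsum_rdistr) auto
  qed (use assms in \<open>auto intro!: finsum_closed\<close>)
  finally show ?thesis .
qed

text \<open>A quadrature rule that evaluates powers up to degree \<open>2 N - 2\<close> at \<open>z\<close>, up to the factor \<open>C\<close>,
  computes the square of the value at \<open>z\<close> of a polynomial with \<open>N\<close> coefficients from the squares of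
  its values at the nodes \<open>T t\<close>.\<close>

lemma (in cring) quadrature_square:
  fixes N :: nat
  assumes "finite I" and w: "\<And>t. t \<in> I \<Longrightarrow> w t \<in> carrier R" and T: "\<And>t. t \<in> I \<Longrightarrow> T t \<in> carrier R"
    and z: "z \<in> carrier R" and C: "C \<in> carrier R"
    and exact: "\<And>n. n < 2 * N - 1 \<Longrightarrow> (\<Oplus>t\<in>I. w t \<otimes> T t [^] n) = C \<otimes> z [^] n"
    and b: "\<And>k. k < N \<Longrightarrow> b k \<in> carrier R"
  shows "(\<Oplus>t\<in>I. w t \<otimes> (\<Oplus>k\<in>{..<N}. b k \<otimes> T t [^] k) [^] (2::nat)) =
    C \<otimes> (\<Oplus>k\<in>{..<N}. b k \<otimes> z [^] k) [^] (2::nat)"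
proof -
  have "(\<Oplus>t\<in>I. w t \<otimes> (\<Oplus>k\<in>{..<N}. b k \<otimes> T t [^] k) [^] (2::nat)) =
      (\<Oplus>t\<in>I. \<Oplus>k\<in>{..<N}. \<Oplus>l\<in>{..<N}. w t \<otimes> ((b k \<otimes> b l) \<otimes> T t [^] (k + l)))"
  proof (rule finsum_cong')
    fix t assume t: "t \<in> I"
    have "(\<Oplus>k\<in>{..<N}. b k \<otimes> T t [^] k) [^] (2::nat) =
        (\<Oplus>k\<in>{..<N}. \<Oplus>l\<in>{..<N}. (b k \<otimes> b l) \<otimes> T t [^] (k + l))"
      using T t b by (intro finsum_square) auto
    also have "w t \<otimes> \<dots> = (\<Oplus>k\<in>{..<N}. \<Oplus>l\<in>{..<N}. w t \<otimes> ((b k \<otimes> b l) \<otimes> T t [^] (k + l)))"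
      using w T b t by (intro finsum_rdistr2) auto
    finally show "w t \<otimes> (\<Oplus>k\<in>{..<N}. b k \<otimes> T t [^] k) [^] (2::nat) =
        (\<Oplus>k\<in>{..<N}. \<Oplus>l\<in>{..<N}. w t \<otimes> ((b k \<otimes> b l) \<otimes> T t [^] (k + l)))" .
  qed (use w T b in \<open>auto intro!: finsum_closed\<close>)
  also have "\<dots> = (\<Oplus>k\<in>{..<N}. \<Oplus>t\<in>I. \<Oplus>l\<in>{..<N}. w t \<otimes> ((b k \<otimes> b l) \<otimes> T t [^] (k + l)))"
    using assms(1) w T b by (intro finsum_swap) (auto intro!: finsum_closed)
  also have "\<dots> = (\<Oplus>k\<in>{..<N}. \<Oplus>l\<in>{..<N}. C \<otimes> ((b k \<otimes> b l) \<otimes> z [^] (k + l)))"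
  proof (rule finsum_cong')
    fix k assume k: "k \<in> {..<N}"
    have "(\<Oplus>t\<in>I. \<Oplus>l\<in>{..<N}. w t \<otimes> ((b k \<otimes> b l) \<otimes> T t [^] (k + l))) =
        (\<Oplus>l\<in>{..<N}. \<Oplus>t\<in>I. w t \<otimes> ((b k \<otimes> b l) \<otimes> T t [^] (k + l)))"
      using assms(1) w T b k by (intro finsum_swap) auto
    also have "\<dots> = (\<Oplus>l\<in>{..<N}. C \<otimes> ((b k \<otimes> b l) \<otimes> z [^] (k + l)))"
    proof (rule finsum_cong')
      fix l assume l: "l \<in> {..<N}"
      have bkl: "b k \<otimes> b l \<in> carrier R" using b k l by auto
      have "(\<Oplus>t\<in>I. w t \<otimes> ((b k \<otimes> b l) \<otimes> T t [^] (k + l))) =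
          (\<Oplus>t\<in>I. (b k \<otimes> b l) \<otimes> (w t \<otimes> T t [^] (k + l)))"
        using w T bkl by (intro finsum_cong') (auto simp: m_lcomm)
      also have "\<dots> = (b k \<otimes> b l) \<otimes> (\<Oplus>t\<in>I. w t \<otimes> T t [^] (k + l))"
        using w T bkl assms(1) by (intro finsum_rdistr[symmetric]) auto
      also have "(\<Oplus>t\<in>I. w t \<otimes> T t [^] (k + l)) = C \<otimes> z [^] (k + l)"
        using k l by (intro exact) auto
      finally show "(\<Oplus>t\<in>I. w t \<otimes> ((b k \<otimes> b l) \<otimes> T t [^] (k + l))) =
          C \<otimes> ((b k \<otimes> b l) \<otimes> z [^] (k + l))"
        using bkl C z by (simp add: m_lcomm)
    qed (use b k C z in auto)
    finally show "(\<Oplus>t\<in>I. \<Oplus>l\<in>{..<N}. w t \<otimes> ((b k \<otimes> b l) \<otimes> T t [^] (k + l))) =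
        (\<Oplus>l\<in>{..<N}. C \<otimes> ((b k \<otimes> b l) \<otimes> z [^] (k + l)))" .
  qed (use b C z in \<open>auto intro!: finsum_closed\<close>)
  also have "\<dots> = C \<otimes> (\<Oplus>k\<in>{..<N}. \<Oplus>l\<in>{..<N}. (b k \<otimes> b l) \<otimes> z [^] (k + l))"
    using b C z by (intro finsum_rdistr2[symmetric]) auto
  finally show ?thesis using z b by (simp add: finsum_square)
qed

text \<open>Entry \<open>n\<close> of row \<open>t\<close> is the coefficient of \<open>X\<^sup>n\<close> in \<open>8!\<close> times the Lagrange polynomial of
  degree 8 that is 1 at \<open>t\<close> and 0 at the other nodes among \<open>0, \<dots>, 8\<close>.\<close>

definition lagrange_table :: "int list list" where
  "lagrange_table =
  [[40320, -109584, 118124, -67284, 22449, -4536, 546, -36, 1],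
   [0, 322560, -554112, 390880, -147392, 32200, -4088, 280, -8],
   [0, -564480, 1251936, -1027768, 428092, -100240, 13384, -952, 28],
   [0, 752640, -1794688, 1606752, -720384, 178920, -25032, 1848, -56],
   [0, -705600, 1741320, -1631840, 769510, -200480, 29260, -2240, 70],
   [0, 451584, -1137024, 1095584, -534464, 144536, -21896, 1736, -56],
   [0, -188160, 480032, -471240, 235452, -65520, 10248, -840, 28],
   [0, 46080, -118656, 118048, -60032, 17080, -2744, 232, -8],
   [0, -5040, 13068, -13132, 6769, -1960, 322, -28, 1]]"

definition lagrange :: "nat \<Rightarrow> nat \<Rightarrow> int" where
  "lagrange t n = lagrange_table ! t ! n"

lemma lagrange_interpolation:
  assumes "n < 9" "k < 9"
  shows "(\<Sum>t<9. lagrange t n * int t ^ k) = (if n = k then 40320 else 0)"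
proof -
  have "\<forall>n\<in>set [0..<9]. \<forall>k\<in>set [0..<9].
      (\<Sum>t\<leftarrow>[0..<9]. lagrange t n * int t ^ k) = (if n = k then 40320 else 0)"
    by code_simp
  moreover have "(\<Sum>t<9. lagrange t n * int t ^ k) = (\<Sum>t\<leftarrow>[0..<9]. lagrange t n * int t ^ k)"
    by (simp only: interv_sum_list_conv_sum_set_nat set_upt atLeast0LessThan)
  ultimately show ?thesis using assms by simp
qed

text \<open>The two factors are the conjugates of \<open>a + b + c\<close> if conjugation fixes \<open>a\<close> and multiplies \<open>b\<close> by
  the primitive cube root of unity \<open>w\<close> and \<open>c\<close> by \<open>w\<^sup>2\<close>.\<close>

lemma (in cring) norm_form_identity:
  assumes carr: "a \<in> carrier R" "b \<in> carrier R" "c \<in> carrier R" "w \<in> carrier R"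
    and w: "\<one> \<oplus> w \<oplus> w \<otimes> w = \<zero>"
  shows "(a \<oplus> w \<otimes> b \<oplus> w \<otimes> w \<otimes> c) \<otimes> (a \<oplus> w \<otimes> w \<otimes> b \<oplus> w \<otimes> c) =
    a \<otimes> a \<oplus> b \<otimes> b \<oplus> c \<otimes> c \<ominus> (a \<otimes> b \<oplus> a \<otimes> c \<oplus> b \<otimes> c)"
proof -
  define f where "f = w \<otimes> w"
  have f: "f \<in> carrier R" using carr by (simp add: f_def)
  have "w \<oplus> f = (\<one> \<oplus> w \<oplus> f) \<oplus> \<ominus> \<one>"
    using carr f by algebra
  then have sum: "w \<oplus> f = \<ominus> \<one>" using w carr by (simp add: f_def)
  have "w \<otimes> f = (\<one> \<oplus> w \<oplus> w \<otimes> w) \<otimes> w \<oplus> \<ominus> (w \<oplus> f)"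
    unfolding f_def using carr by algebra
  then have prod: "w \<otimes> f = \<one>" using carr by (simp add: w sum)
  have "w \<otimes> w \<oplus> f \<otimes> f = f \<oplus> w \<otimes> (w \<otimes> f)"
    unfolding f_def using carr by algebra
  then have sq: "w \<otimes> w \<oplus> f \<otimes> f = \<ominus> \<one>"
    using sum f carr by (simp add: prod a_comm)
  have "(a \<oplus> w \<otimes> b \<oplus> f \<otimes> c) \<otimes> (a \<oplus> f \<otimes> b \<oplus> w \<otimes> c) =
      a \<otimes> a \<oplus> (w \<otimes> f) \<otimes> (b \<otimes> b \<oplus> c \<otimes> c) \<oplus> (w \<oplus> f) \<otimes> (a \<otimes> b \<oplus> a \<otimes> c) \<oplus> (w \<otimes> w \<oplus> f \<otimes> f) \<otimes> (b \<otimes> c)"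
    using carr f by (simp add: l_distr r_distr m_ac a_ac)
  also have "\<dots> = a \<otimes> a \<oplus> b \<otimes> b \<oplus> c \<otimes> c \<ominus> (a \<otimes> b \<oplus> a \<otimes> c \<oplus> b \<otimes> c)"
    unfolding sum prod sq using carr by algebra
  finally show ?thesis unfolding f_def .
qed


section \<open>The product of conjugates\<close>

text \<open>Twice the quadratic form of \<open>norm_form_identity\<close> at \<open>a, b v, c v\<^sup>2\<close>, as a combination of the
  squares of \<open>a\<close>, \<open>b\<close>, \<open>c\<close> and their pairwise sums, by means of
  \<open>2 a b = (a + b)\<^sup>2 - a\<^sup>2 - b\<^sup>2\<close>.\<close>

lemma (in cring) squares_identity:
  assumes carr: "a \<in> carrier R" "b \<in> carrier R" "c \<in> carrier R" "v \<in> carrier R"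
  shows "(\<one> \<oplus> \<one> \<oplus> v \<oplus> v \<otimes> v) \<otimes> (a \<otimes> a) \<oplus>
    (v \<oplus> (v \<otimes> v \<oplus> v \<otimes> v) \<oplus> v \<otimes> v \<otimes> v) \<otimes> (b \<otimes> b) \<oplus>
    (v \<otimes> v \<oplus> v \<otimes> v \<otimes> v \<oplus> (v \<otimes> v \<otimes> v \<otimes> v \<oplus> v \<otimes> v \<otimes> v \<otimes> v)) \<otimes> (c \<otimes> c) \<oplus>
    \<ominus> (v \<otimes> v \<otimes> v) \<otimes> ((b \<oplus> c) \<otimes> (b \<oplus> c)) \<oplus>
    \<ominus> (v \<otimes> v) \<otimes> ((a \<oplus> c) \<otimes> (a \<oplus> c)) \<oplus>
    \<ominus> v \<otimes> ((a \<oplus> b) \<otimes> (a \<oplus> b)) =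
    (\<one> \<oplus> \<one>) \<otimes> (a \<otimes> a \<oplus> (b \<otimes> v) \<otimes> (b \<otimes> v) \<oplus> (c \<otimes> (v \<otimes> v)) \<otimes> (c \<otimes> (v \<otimes> v)) \<ominus>
      (a \<otimes> (b \<otimes> v) \<oplus> a \<otimes> (c \<otimes> (v \<otimes> v)) \<oplus> (b \<otimes> v) \<otimes> (c \<otimes> (v \<otimes> v))))"
proof -
  define d where "d = a \<otimes> a \<oplus> (b \<otimes> v) \<otimes> (b \<otimes> v) \<oplus> (c \<otimes> (v \<otimes> v)) \<otimes> (c \<otimes> (v \<otimes> v))"
  have pos: "(\<one> \<oplus> \<one> \<oplus> v \<oplus> v \<otimes> v) \<otimes> (a \<otimes> a) \<oplus>
    (v \<oplus> (v \<otimes> v \<oplus> v \<otimes> v) \<oplus> v \<otimes> v \<otimes> v) \<otimes> (b \<otimes> b) \<oplus>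
    (v \<otimes> v \<oplus> v \<otimes> v \<otimes> v \<oplus> (v \<otimes> v \<otimes> v \<otimes> v \<oplus> v \<otimes> v \<otimes> v \<otimes> v)) \<otimes> (c \<otimes> c) =
    (\<one> \<oplus> \<one>) \<otimes> d \<oplus> v \<otimes> (a \<otimes> a \<oplus> b \<otimes> b) \<oplus> (v \<otimes> v) \<otimes> (a \<otimes> a \<oplus> c \<otimes> c) \<oplus>
      (v \<otimes> v \<otimes> v) \<otimes> (b \<otimes> b \<oplus> c \<otimes> c)"
    using carr by (simp add: d_def l_distr r_distr m_ac a_ac)
  have neg: "\<ominus> w \<otimes> ((x \<oplus> y) \<otimes> (x \<oplus> y)) = \<ominus> (w \<otimes> (x \<otimes> x \<oplus> y \<otimes> y)) \<oplus> \<ominus> (w \<otimes> (x \<otimes> y) \<oplus> w \<otimes> (x \<otimes> y))"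
    if "w \<in> carrier R" "x \<in> carrier R" "y \<in> carrier R" for w x y
    using that by algebra
  have cancel: "d2 \<oplus> x \<oplus> y \<oplus> z \<oplus> (\<ominus> z \<oplus> p) \<oplus> (\<ominus> y \<oplus> q) \<oplus> (\<ominus> x \<oplus> r) = d2 \<oplus> p \<oplus> q \<oplus> r"
    if "d2 \<in> carrier R" "x \<in> carrier R" "y \<in> carrier R" "z \<in> carrier R"
       "p \<in> carrier R" "q \<in> carrier R" "r \<in> carrier R" for d2 x y z p q r
    using that by algebra
  have "(\<one> \<oplus> \<one>) \<otimes> d \<oplus> \<ominus> (v \<otimes> v \<otimes> v \<otimes> (b \<otimes> c) \<oplus> v \<otimes> v \<otimes> v \<otimes> (b \<otimes> c)) \<oplus>
      \<ominus> (v \<otimes> v \<otimes> (a \<otimes> c) \<oplus> v \<otimes> v \<otimes> (a \<otimes> c)) \<oplus> \<ominus> (v \<otimes> (a \<otimes> b) \<oplus> v \<otimes> (a \<otimes> b)) =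
      (\<one> \<oplus> \<one>) \<otimes> (d \<ominus> (a \<otimes> (b \<otimes> v) \<oplus> a \<otimes> (c \<otimes> (v \<otimes> v)) \<oplus> (b \<otimes> v) \<otimes> (c \<otimes> (v \<otimes> v))))"
  proof -
    have "d \<in> carrier R" using carr by (simp add: d_def)
    with carr show ?thesis by (clarsimp simp: l_distr r_distr minus_eq minus_add m_ac a_ac)
  qed
  with carr show ?thesis
    unfolding pos by (simp add: neg cancel d_def)
qed

context tower15
begin

text \<open>The \<open>j\<close>-th coordinate over \<open>K(u)\<close>, with respect to \<open>1, v, v\<^sup>2\<close>.\<close>

definition component :: "'a list \<Rightarrow> nat \<Rightarrow> 'a" where
  "component xs j = (\<Oplus>i\<in>{..<5}. xs ! (3 * i + j) \<otimes> u [^] i)"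

lemma component_closed:
  assumes "length xs = 15" "set xs \<subseteq> K" "j < 3"
  shows "component xs j \<in> carrier L"
proof -
  have "xs ! (3 * i + j) \<in> K" if "i < 5" for i
    using that assms by auto
  then show ?thesis
    using K_carrier u_carrier by (auto simp: component_def intro!: finsum_closed)
qed

lemma scaled_coords_eq:
  assumes xs: "length xs = 15" "set xs \<subseteq> K" and w: "w \<in> carrier L" "w [^] (3::nat) = \<one>"
  shows "(\<Oplus>m\<in>{..<15}. (xs ! m \<otimes> w [^] m) \<otimes> v [^] m) =
    component xs 0 \<oplus> w \<otimes> (component xs 1 \<otimes> v) \<oplus> w \<otimes> w \<otimes> (component xs 2 \<otimes> (v \<otimes> v))"
proof -
  have xm: "xs ! m \<in> carrier L" if "m < 15" for m
    using that xs by (intro K_carrier) auto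
  then have x: "xs ! (3 * i + j) \<in> carrier L" if "i < 5" "j < 3" for i j
    using that by simp
  have wv: "w [^] (3 * i + j) = w [^] j" "v [^] (3 * i + j) = u [^] i \<otimes> v [^] j" for i j :: nat
    using w v_carrier by (simp_all add: v_pow flip: nat_pow_mult nat_pow_pow)
  define f where "f j i = (xs ! (3 * i + j) \<otimes> u [^] i) \<otimes> (w [^] j \<otimes> v [^] j)" for i j :: nat
  have f: "f j i \<in> carrier L" if "i < 5" "j < 3" for i j
    using that x w(1) u_carrier v_carrier by (simp add: f_def)
  have sum_f: "(\<Oplus>i\<in>{..<5}. f j i) = component xs j \<otimes> (w [^] j \<otimes> v [^] j)" if "j < 3" for j
    unfolding f_def component_def using that x w(1) u_carrier v_carrier
    by (intro finsum_ldistr[symmetric]) auto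
  have "(\<Oplus>m\<in>{..<5 * 3}. (xs ! m \<otimes> w [^] m) \<otimes> v [^] m) =
      (\<Oplus>i\<in>{..<5}. \<Oplus>j\<in>{..<3}. (xs ! (3 * i + j) \<otimes> w [^] (3 * i + j)) \<otimes> v [^] (3 * i + j))"
    using xm w(1) v_carrier by (intro finsum_split_blocks) simp
  also have "\<dots> = (\<Oplus>i\<in>{..<5}. f 0 i \<oplus> f 1 i \<oplus> f 2 i)"
  proof (rule finsum_cong')
    fix i :: nat assume i: "i \<in> {..<5}"
    have "(xs ! (3 * i + j) \<otimes> w [^] (3 * i + j)) \<otimes> v [^] (3 * i + j) = f j i" if "j < 3" for j
      unfolding wv f_def using x[of i j] that i w(1) u_carrier v_carrier by (simp add: m_ac)
    then have "(\<Oplus>j\<in>{..<3}. (xs ! (3 * i + j) \<otimes> w [^] (3 * i + j)) \<otimes> v [^] (3 * i + j)) =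
        (\<Oplus>j\<in>{..<3}. f j i)"
      using f i by (intro finsum_cong') auto
    also have "\<dots> = f 0 i \<oplus> f 1 i \<oplus> f 2 i"
      using f i by (simp add: numeral_3_eq_3 finsum_lessThan_Suc numeral_2_eq_2 finsum_zero)
    finally show "(\<Oplus>j\<in>{..<3}. (xs ! (3 * i + j) \<otimes> w [^] (3 * i + j)) \<otimes> v [^] (3 * i + j)) =
        f 0 i \<oplus> f 1 i \<oplus> f 2 i" .
  qed (use f in auto)
  also have "\<dots> = (\<Oplus>i\<in>{..<5}. f 0 i) \<oplus> (\<Oplus>i\<in>{..<5}. f 1 i) \<oplus> (\<Oplus>i\<in>{..<5}. f 2 i)"
    using f by (simp add: finsum_addf Pi_def)
  also have "\<dots> = component xs 0 \<oplus> w \<otimes> (component xs 1 \<otimes> v) \<oplus> w \<otimes> w \<otimes> (component xs 2 \<otimes> (v \<otimes> v))"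
    using component_closed[OF xs] w(1) v_carrier by (simp add: sum_f m_ac numeral_2_eq_2)
  finally show ?thesis by simp
qed

lemma G_phi3_inv:
  assumes "\<alpha> \<in> G_phi3 p L"
  shows "inv \<alpha> = frobenius 5 p L \<alpha> \<otimes> frobenius 10 p L \<alpha>"
proof -
  have \<alpha>: "\<alpha> \<in> carrier L" "\<alpha> [^] (p ^ 10 + p ^ 5 + 1) = \<one>"
    using assms by (auto simp: G_phi3_def)
  have "\<alpha> \<otimes> (frobenius 5 p L \<alpha> \<otimes> frobenius 10 p L \<alpha>) = \<alpha> [^] (p ^ 10 + p ^ 5 + 1)"
    using \<alpha>(1) by (simp add: frobenius_def m_ac flip: nat_pow_mult)
  with \<alpha> show ?thesis
    by (intro comm_inv_char) (auto simp: frobenius_def)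
qed

lemma frobenius_product:
  assumes xs: "length xs = 15" "set xs \<subseteq> K"
  defines "a \<equiv> component xs 0" and "b \<equiv> component xs 1 \<otimes> v" and "c \<equiv> component xs 2 \<otimes> (v \<otimes> v)"
  shows "frobenius 5 p L (of_coords L u v xs) \<otimes> frobenius 10 p L (of_coords L u v xs) =
    a \<otimes> a \<oplus> b \<otimes> b \<oplus> c \<otimes> c \<ominus> (a \<otimes> b \<oplus> a \<otimes> c \<oplus> b \<otimes> c)"
proof -
  define w where "w = \<zeta> [^] (5::nat)"
  have w: "w \<in> carrier L" by (simp add: w_def)
  have w3: "w [^] (3::nat) = \<one>" by (simp add: w_def nat_pow_pow \<zeta>_pow15)
  then have w3': "w \<otimes> w \<otimes> w = \<one>" using w by (simp add: numeral_3_eq_3)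
  have abc: "a \<in> carrier L" "b \<in> carrier L" "c \<in> carrier L"
    using component_closed[OF xs] v_carrier by (auto simp: a_def b_def c_def)
  have "(w \<ominus> \<one>) \<otimes> (\<one> \<oplus> w \<oplus> w \<otimes> w) = w \<otimes> w \<otimes> w \<ominus> \<one>"
    using w by algebra
  then have "(w \<ominus> \<one>) \<otimes> (\<one> \<oplus> w \<oplus> w \<otimes> w) = \<zero>"
    by (simp add: w3')
  moreover have "w \<ominus> \<one> \<noteq> \<zero>"
    using \<zeta>_pow5 w by (simp add: w_def)
  ultimately have w_sum: "\<one> \<oplus> w \<oplus> w \<otimes> w = \<zero>"
    using integral[of "w \<ominus> \<one>" "\<one> \<oplus> w \<oplus> w \<otimes> w"] w by auto
  have five: "frobenius 5 p L (of_coords L u v xs) = a \<oplus> w \<otimes> b \<oplus> w \<otimes> w \<otimes> c"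
    unfolding frobenius_of_coords[OF xs] a_def b_def c_def
    using scaled_coords_eq[OF xs w w3] by (simp add: w_def nat_pow_pow)
  have ww: "w \<otimes> w \<in> carrier L" "(w \<otimes> w) [^] (3::nat) = \<one>" "w \<otimes> w \<otimes> (w \<otimes> w) = w"
    using w w3 w3' by (simp_all add: nat_pow_distrib flip: m_assoc)
  have "\<zeta> [^] (10 * m) = (w \<otimes> w) [^] m" for m :: nat
    by (simp add: w_def nat_pow_mult nat_pow_pow)
  then have ten: "frobenius 10 p L (of_coords L u v xs) = a \<oplus> w \<otimes> w \<otimes> b \<oplus> w \<otimes> c"
    unfolding frobenius_of_coords[OF xs] a_def b_def c_def
    using scaled_coords_eq[OF xs ww(1,2)] by (simp add: ww(3))
  show ?thesis
    unfolding five ten by (rule norm_form_identity[OF abc w w_sum])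
qed

end


section \<open>Cost of the inversion\<close>

text \<open>The \<open>s\<close>-th square of the inversion program, \<open>s = 9 \<beta> + t\<close>, is the square at the node \<open>t\<close> of the
  \<open>\<beta>\<close>-th of the six polynomials \<open>A\<^sub>0, A\<^sub>1, A\<^sub>2, A\<^sub>1 + A\<^sub>2, A\<^sub>0 + A\<^sub>2, A\<^sub>0 + A\<^sub>1\<close>, where \<open>A\<^sub>j\<close> has the
  coefficients \<open>x\<^sub>j, x\<^bsub>3 + j\<^esub>, \<dots>, x\<^bsub>12 + j\<^esub>\<close> among the input coordinates. This is the coefficient of
  \<open>A\<^sub>j\<close> in the \<open>\<beta>\<close>-th polynomial.\<close>

definition summand_coeff :: "nat \<Rightarrow> nat \<Rightarrow> int" where
  "summand_coeff \<beta> j = [[1, 0, 0], [0, 1, 0], [0, 0, 1], [0, 1, 1], [1, 0, 1], [1, 1, 0]] ! \<beta> ! j"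

text \<open>The coefficient of \<open>v\<^sup>r\<close> in the factor of the \<open>\<beta>\<close>-th square in \<open>squares_identity\<close>.\<close>

definition square_coeff :: "nat \<Rightarrow> nat \<Rightarrow> int" where
  "square_coeff \<beta> r =
     [[2, 1, 1, 0, 0], [0, 1, 2, 1, 0], [0, 0, 1, 1, 2],
      [0, 0, 0, - 1, 0], [0, 0, - 1, 0, 0], [0, - 1, 0, 0, 0]] ! \<beta> ! r"

text \<open>The coefficient of the input coordinate \<open>m\<close> in the linear form of which the \<open>s\<close>-th
  square is taken.\<close>

definition form_coeff :: "nat \<Rightarrow> nat \<Rightarrow> int" where
  "form_coeff s m = summand_coeff (s div 9) (m mod 3) * int (s mod 9) ^ (m div 3)"

text \<open>The coefficient, before division by \<open>2 \<sqdot> 8!\<close>, of the \<open>s\<close>-th square in the output coordinate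
  \<open>m\<close>: the coordinate \<open>m\<close> of the product of the factor given by \<open>square_coeff\<close> and the value at
  \<open>u = v\<^sup>3\<close> of \<open>8!\<close> times the Lagrange polynomial of the node. Its terms \<open>v\<^sup>e\<close> are
  enumerated by \<open>k\<close> and reduced by \<open>v\<^sup>1\<^sup>5 = 7\<close>.\<close>

definition output_coeff :: "nat \<Rightarrow> nat \<Rightarrow> int" where
  "output_coeff m s =
     (\<Sum>k<45. let e = 3 * (k div 5) + k mod 5 in
        if e mod 15 = m then lagrange (s mod 9) (k div 5) * square_coeff (s div 9) (k mod 5) *
          7 ^ (e div 15)
        else 0)"

text \<open>Inversion on \<open>G_phi3\<close> by 54 squarings; \<open>80640\<close> is \<open>2 \<sqdot> 8!\<close>.\<close>

definition inverse_prog :: slp where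
  "inverse_prog = quad_prog 54 (\<lambda>s m. of_int (form_coeff s m))
     (\<lambda>m s. of_int (output_coeff m s) / of_int 80640)"

context tower15
begin

lemma reduce_powers_v:
  fixes N :: nat
  shows "(\<Oplus>m\<in>{..<15}. of_integer (\<Sum>k<N.
      if e k mod 15 = m then c k * 7 ^ (e k div 15) else 0) \<otimes> v [^] m) =
   (\<Oplus>k\<in>{..<N}. of_integer (c k) \<otimes> v [^] e k)"
proof (induction N)
  case 0
  then show ?case using v_carrier by (simp add: finsum_zero)
next
  case (Suc N)
  define g where "g m = of_integer (c N * 7 ^ (e N div 15)) \<otimes> v [^] m" for m :: nat
  have g: "g m \<in> carrier L" for m using v_carrier by (simp add: g_def)
  have "e N = 15 * (e N div 15) + e N mod 15" by simp
  then have "v [^] e N = (v [^] (15::nat)) [^] (e N div 15) \<otimes> v [^] (e N mod 15)"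
    using v_carrier by (metis nat_pow_mult nat_pow_pow)
  then have last: "g (e N mod 15) = of_integer (c N) \<otimes> v [^] e N"
    using v_carrier by (simp add: g_def of_integer_mult of_integer_power v_pow15 m_assoc)
  have "(\<Oplus>m\<in>{..<15}. of_integer (\<Sum>k<Suc N. if e k mod 15 =
      m then c k * 7 ^ (e k div 15) else 0) \<otimes> v [^] m) =
      (\<Oplus>m\<in>{..<15}. of_integer (\<Sum>k<N. if e k mod 15 =
          m then c k * 7 ^ (e k div 15) else 0) \<otimes> v [^] m \<oplus>
        (if e N mod 15 = m then g m else \<zero>))"
    using v_carrier g
    by (intro finsum_cong') (auto simp: of_integer_add l_distr g_def)
  also have "\<dots> = (\<Oplus>k\<in>{..<N}. of_integer (c k) \<otimes> v [^] e k) \<oplus>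
      (\<Oplus>m\<in>{..<15}. if e N mod 15 = m then g m else \<zero>)"
    using v_carrier g by (subst finsum_addf) (auto simp: Suc)
  also have "(\<Oplus>m\<in>{..<15}. if e N mod 15 = m then g m else \<zero>) = g (e N mod 15)"
    using g by (intro finsum_singleton) auto
  finally show ?case
    using v_carrier by (simp add: last finsum_lessThan_Suc)
qed

lemma lagrange_quadrature:
  fixes n :: nat
  assumes "n < 9"
  shows "(\<Oplus>t\<in>{..<9}. (\<Oplus>k\<in>{..<9}. of_integer (lagrange t k) \<otimes> u [^] k) \<otimes> of_integer (int t) [^] n) =
    of_integer 40320 \<otimes> u [^] n"
proof -
  have "(\<Oplus>t\<in>{..<9}. (\<Oplus>k\<in>{..<9}. of_integer (lagrange t k) \<otimes> u [^] k) \<otimes> of_integer (int t) [^] n) =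
      (\<Oplus>t\<in>{..<9}. \<Oplus>k\<in>{..<9}. (of_integer (lagrange t k) \<otimes> u [^] k) \<otimes> of_integer (int t) [^] n)"
    using u_carrier by (intro finsum_cong' finsum_ldistr) (auto intro!: finsum_closed)
  also have "\<dots> = (\<Oplus>k\<in>{..<9}. \<Oplus>t\<in>{..<9}. (of_integer (lagrange t k) \<otimes> u [^] k) \<otimes>
      of_integer (int t) [^] n)"
    using u_carrier by (intro finsum_swap) auto
  also have "\<dots> = (\<Oplus>k\<in>{..<9}. if n = k then of_integer 40320 \<otimes> u [^] k else \<zero>)"
  proof (rule finsum_cong')
    fix k :: nat assume k: "k \<in> {..<9}"
    have "(\<Oplus>t\<in>{..<9}. (of_integer (lagrange t k) \<otimes> u [^] k) \<otimes> of_integer (int t) [^] n) =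
        (\<Oplus>t\<in>{..<9}. of_integer (lagrange t k * int t ^ n) \<otimes> u [^] k)"
      using u_carrier by (intro finsum_cong') (auto simp: of_integer_mult of_integer_power m_ac)
    also have "\<dots> = of_integer (\<Sum>t<9. lagrange t k * int t ^ n) \<otimes> u [^] k"
      using u_carrier by (subst finsum_ldistr[symmetric]) (auto simp: of_integer_sum)
    finally show "(\<Oplus>t\<in>{..<9}. (of_integer (lagrange t k) \<otimes> u [^] k) \<otimes> of_integer (int t) [^] n) =
        (if n = k then of_integer 40320 \<otimes> u [^] k else \<zero>)"
      using k assms u_carrier by (simp add: lagrange_interpolation)
  qed (use u_carrier in auto)
  also have "\<dots> = of_integer 40320 \<otimes> u [^] n"
    using assms u_carrier by (intro finsum_singleton) auto
  finally show ?thesis .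
qed

lemma output_coeff_sum:
  assumes "\<beta> < 6" "t < 9"
  shows "(\<Oplus>m\<in>{..<15}. of_integer (output_coeff m (9 * \<beta> + t)) \<otimes> v [^] m) =
    (\<Oplus>k\<in>{..<9}. of_integer (lagrange t k) \<otimes> u [^] k) \<otimes>
    (\<Oplus>r\<in>{..<5}. of_integer (square_coeff \<beta> r) \<otimes> v [^] r)"
proof -
  have dm: "(9 * \<beta> + t) mod 9 = t" "(9 * \<beta> + t) div 9 = \<beta>"
    using assms(2) by (simp_all add: div_nat_eqI)
  define c where "c k = lagrange t (k div 5) * square_coeff \<beta> (k mod 5)" for k
  have "(\<Oplus>m\<in>{..<15}. of_integer (output_coeff m (9 * \<beta> + t)) \<otimes> v [^] m) =
      (\<Oplus>k\<in>{..<9 * 5}. of_integer (c k) \<otimes> v [^] (3 * (k div 5) + k mod 5))"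
    using reduce_powers_v[where N = 45 and e = "\<lambda>k. 3 * (k div 5) + k mod 5" and c = c]
    unfolding output_coeff_def dm Let_def c_def[symmetric] by simp
  also have "\<dots> = (\<Oplus>k\<in>{..<9}. \<Oplus>r\<in>{..<5}. of_integer (c (5 * k + r)) \<otimes>
      v [^] (3 * ((5 * k + r) div 5) + (5 * k + r) mod 5))"
    using v_carrier by (intro finsum_split_blocks) auto
  also have "\<dots> = (\<Oplus>k\<in>{..<9}. \<Oplus>r\<in>{..<5}. (of_integer (lagrange t k) \<otimes> u [^] k) \<otimes>
      (of_integer (square_coeff \<beta> r) \<otimes> v [^] r))"
  proof -
    have "v [^] (3 * k + r) = u [^] k \<otimes> v [^] r" for k r :: nat
      using v_carrier by (simp add: v_pow flip: nat_pow_mult nat_pow_pow)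
    then show ?thesis
      using u_carrier v_carrier
      by (intro finsum_cong') (auto intro!: finsum_closed simp: c_def of_integer_mult m_ac)
  qed
  also have "\<dots> = (\<Oplus>k\<in>{..<9}. of_integer (lagrange t k) \<otimes> u [^] k) \<otimes>
    (\<Oplus>r\<in>{..<5}. of_integer (square_coeff \<beta> r) \<otimes> v [^] r)"
    using u_carrier v_carrier by (intro finsum_mult[symmetric]) auto
  finally show ?thesis .
qed

lemma form_coeff_sum:
  assumes xs: "length xs = 15" "set xs \<subseteq> K" and "\<beta> < 6" "t < 9"
  shows "(\<Oplus>m\<in>{..<15}. of_integer (form_coeff (9 * \<beta> + t) m) \<otimes> xs ! m) =
    (\<Oplus>i\<in>{..<5}. (\<Oplus>j\<in>{..<3}. of_integer (summand_coeff \<beta> j) \<otimes> xs ! (3 * i + j)) \<otimes>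
        of_integer (int t) [^] i)"
proof -
  have xm: "xs ! m \<in> carrier L" if "m < 15" for m
    using that xs by (intro K_carrier) auto
  then have x: "xs ! (3 * i + j) \<in> carrier L" if "i < 5" "j < 3" for i j
    using that by simp
  have dm: "(9 * \<beta> + t) mod 9 = t" "(9 * \<beta> + t) div 9 = \<beta>"
    using assms(4) by (simp_all add: div_nat_eqI)
  have "(\<Oplus>m\<in>{..<5 * 3}. of_integer (form_coeff (9 * \<beta> + t) m) \<otimes> xs ! m) =
      (\<Oplus>i\<in>{..<5}. \<Oplus>j\<in>{..<3}. of_integer (form_coeff (9 * \<beta> + t) (3 * i + j)) \<otimes> xs ! (3 * i + j))"
    using xm by (intro finsum_split_blocks) simp
  also have "\<dots> = (\<Oplus>i\<in>{..<5}. \<Oplus>j\<in>{..<3}. (of_integer (summand_coeff \<beta> j) \<otimes> xs ! (3 * i + j)) \<otimes>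
      of_integer (int t) [^] i)"
    using x assms(4)
    by (intro finsum_cong') (auto intro!: finsum_closed
        simp: form_coeff_def dm of_integer_mult of_integer_power m_ac)
  also have "\<dots> = (\<Oplus>i\<in>{..<5}. (\<Oplus>j\<in>{..<3}. of_integer (summand_coeff \<beta> j) \<otimes> xs ! (3 * i + j)) \<otimes>
      of_integer (int t) [^] i)"
    using x by (intro finsum_cong' finsum_ldistr[symmetric]) (auto intro!: finsum_closed)
  finally show ?thesis by simp
qed

lemma summand_sum:
  assumes xs: "length xs = 15" "set xs \<subseteq> K"
  shows "(\<Oplus>i\<in>{..<5}. (\<Oplus>j\<in>{..<3}. of_integer (summand_coeff \<beta> j) \<otimes> xs ! (3 * i + j)) \<otimes> u [^] i) =
    (\<Oplus>j\<in>{..<3}. of_integer (summand_coeff \<beta> j) \<otimes> component xs j)"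
proof -
  have x: "xs ! (3 * i + j) \<in> carrier L" if "i < 5" "j < 3" for i j
    using that xs by (intro K_carrier) auto
  have "(\<Oplus>i\<in>{..<5}. (\<Oplus>j\<in>{..<3}. of_integer (summand_coeff \<beta> j) \<otimes> xs ! (3 * i + j)) \<otimes> u [^] i) =
      (\<Oplus>i\<in>{..<5}. \<Oplus>j\<in>{..<3}. (of_integer (summand_coeff \<beta> j) \<otimes> xs ! (3 * i + j)) \<otimes> u [^] i)"
    using x u_carrier by (intro finsum_cong' finsum_ldistr) (auto intro!: finsum_closed)
  also have "\<dots> = (\<Oplus>j\<in>{..<3}. \<Oplus>i\<in>{..<5}. (of_integer (summand_coeff \<beta> j) \<otimes> xs ! (3 * i + j)) \<otimes> u [^] i)"
    using x u_carrier by (intro finsum_swap) auto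
  also have "\<dots> = (\<Oplus>j\<in>{..<3}. of_integer (summand_coeff \<beta> j) \<otimes> component xs j)"
  proof (rule finsum_cong')
    fix j :: nat assume j: "j \<in> {..<3}"
    have "(\<Oplus>i\<in>{..<5}. (of_integer (summand_coeff \<beta> j) \<otimes> xs ! (3 * i + j)) \<otimes> u [^] i) =
        (\<Oplus>i\<in>{..<5}. of_integer (summand_coeff \<beta> j) \<otimes> (xs ! (3 * i + j) \<otimes> u [^] i))"
      using x j u_carrier by (intro finsum_cong') (auto simp: m_assoc)
    also have "\<dots> = of_integer (summand_coeff \<beta> j) \<otimes> component xs j"
      unfolding component_def using x j u_carrier by (intro finsum_rdistr[symmetric]) auto
    finally show "(\<Oplus>i\<in>{..<5}. (of_integer (summand_coeff \<beta> j) \<otimes> xs ! (3 * i + j)) \<otimes> u [^] i) =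
        of_integer (summand_coeff \<beta> j) \<otimes> component xs j" .
  qed (use component_closed[OF xs] in auto)
  finally show ?thesis .
qed

lemma squares_sum:
  assumes xs: "length xs = 15" "set xs \<subseteq> K"
  shows "(\<Oplus>\<beta>\<in>{..<6}. (\<Oplus>r\<in>{..<5}. of_integer (square_coeff \<beta> r) \<otimes> v [^] r) \<otimes>
      (\<Oplus>j\<in>{..<3}. of_integer (summand_coeff \<beta> j) \<otimes> component xs j) [^] (2::nat)) =
    of_integer 2 \<otimes> (frobenius 5 p L (of_coords L u v xs) \<otimes> frobenius 10 p L (of_coords L u v xs))"
proof -
  define a b c where "a = component xs 0" and "b = component xs 1" and "c = component xs 2"
  have [simp]: "a \<in> carrier L" "b \<in> carrier L" "c \<in> carrier L" "v \<in> carrier L"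
    using component_closed[OF xs] v_carrier by (auto simp: a_def b_def c_def)
  have two: "of_integer 2 = \<one> \<oplus> \<one>" using of_integer_add[of 1 1] by simp
  have three: "(\<Oplus>j\<in>{..<3}. f j) = f 0 \<oplus> f 1 \<oplus> f 2"
      if "\<And>j. j < 3 \<Longrightarrow> f j \<in> carrier L" for f :: "nat \<Rightarrow> 'a"
    using that by (simp add: finsum_lessThan_Suc finsum_zero numeral_eq_Suc)
  have five: "(\<Oplus>r\<in>{..<5}. f r) = f 0 \<oplus> f 1 \<oplus> f 2 \<oplus> f 3 \<oplus> f 4"
      if "\<And>j. j < 5 \<Longrightarrow> f j \<in> carrier L" for f :: "nat \<Rightarrow> 'a"
    using that by (simp add: finsum_lessThan_Suc finsum_zero numeral_eq_Suc)
  have six: "(\<Oplus>r\<in>{..<6}. f r) = f 0 \<oplus> f 1 \<oplus> f 2 \<oplus> f 3 \<oplus> f 4 \<oplus> f 5"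
    if "\<And>j. j < 6 \<Longrightarrow> f j \<in> carrier L" for f :: "nat \<Rightarrow> 'a"
    using that by (simp add: finsum_lessThan_Suc finsum_zero numeral_eq_Suc)
  define \<sigma> where "\<sigma> \<beta> = (\<Oplus>j\<in>{..<3}. of_integer (summand_coeff \<beta> j) \<otimes> component xs j)" for \<beta>
  define \<psi> where "\<psi> \<beta> = (\<Oplus>r\<in>{..<5}. of_integer (square_coeff \<beta> r) \<otimes> v [^] r)" for \<beta>
  have closed: "\<sigma> \<beta> \<in> carrier L" "\<psi> \<beta> \<in> carrier L" for \<beta>
    using component_closed[OF xs] by (auto simp: \<sigma>_def \<psi>_def intro!: finsum_closed)
  have \<sigma>_eq: "\<sigma> \<beta> = of_integer (summand_coeff \<beta> 0) \<otimes> a \<oplus> of_integer (summand_coeff \<beta> 1) \<otimes> b \<oplus>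
      of_integer (summand_coeff \<beta> 2) \<otimes> c" for \<beta>
    unfolding \<sigma>_def a_def b_def c_def using component_closed[OF xs] by (intro three) auto
  have \<sigma>: "\<sigma> 0 = a" "\<sigma> 1 = b" "\<sigma> 2 = c" "\<sigma> 3 = b \<oplus> c" "\<sigma> 4 = a \<oplus> c" "\<sigma> 5 = a \<oplus> b"
    by (simp_all add: \<sigma>_eq summand_coeff_def)
  have \<psi>_eq: "\<psi> \<beta> = of_integer (square_coeff \<beta> 0) \<oplus> of_integer (square_coeff \<beta> 1) \<otimes> v \<oplus>
      of_integer (square_coeff \<beta> 2) \<otimes> (v \<otimes> v) \<oplus> of_integer (square_coeff \<beta> 3) \<otimes> (v \<otimes> v \<otimes> v) \<oplus>
      of_integer (square_coeff \<beta> 4) \<otimes> (v \<otimes> v \<otimes> v \<otimes> v)" for \<beta>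
    unfolding \<psi>_def by (subst five) (auto simp: numeral_eq_Suc)
  have \<psi>: "\<psi> 0 = \<one> \<oplus> \<one> \<oplus> v \<oplus> v \<otimes> v"
    "\<psi> 1 = v \<oplus> (v \<otimes> v \<oplus> v \<otimes> v) \<oplus> v \<otimes> v \<otimes> v"
    "\<psi> 2 = v \<otimes> v \<oplus> v \<otimes> v \<otimes> v \<oplus> (v \<otimes> v \<otimes> v \<otimes> v \<oplus> v \<otimes> v \<otimes> v \<otimes> v)"
    "\<psi> 3 = \<ominus> (v \<otimes> v \<otimes> v)" "\<psi> 4 = \<ominus> (v \<otimes> v)" "\<psi> 5 = \<ominus> v"
    by (simp_all add: \<psi>_eq square_coeff_def two of_integer_minus l_distr l_minus)
  have "(\<Oplus>\<beta>\<in>{..<6}. \<psi> \<beta> \<otimes> \<sigma> \<beta> [^] (2::nat)) =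
      \<psi> 0 \<otimes> (a \<otimes> a) \<oplus> \<psi> 1 \<otimes> (b \<otimes> b) \<oplus> \<psi> 2 \<otimes> (c \<otimes> c) \<oplus> \<psi> 3 \<otimes> ((b \<oplus> c) \<otimes> (b \<oplus> c)) \<oplus>
      \<psi> 4 \<otimes> ((a \<oplus> c) \<otimes> (a \<oplus> c)) \<oplus> \<psi> 5 \<otimes> ((a \<oplus> b) \<otimes> (a \<oplus> b))"
  proof -
    have sq: "y [^] (2::nat) = y \<otimes> y" if "y \<in> carrier L" for y
      using that by (simp add: numeral_2_eq_2)
    then show ?thesis using closed by (subst six) (simp_all add: \<sigma> \<sigma>(2)[unfolded One_nat_def] sq)
  qed
  also have "\<dots> =
      of_integer 2 \<otimes> (frobenius 5 p L (of_coords L u v xs) \<otimes> frobenius 10 p L (of_coords L u v xs))"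
    unfolding \<psi> two frobenius_product[OF xs] a_def[symmetric] b_def[symmetric] c_def[symmetric]
    by (rule squares_identity) auto
  finally show ?thesis by (simp add: \<sigma>_def \<psi>_def)
qed

text \<open>The denominator has no prime factor greater than 7, whereas \<open>p > 15\<close>.\<close>

lemma denominator_nonzero: "of_integer 80640 \<noteq> \<zero>"
proof
  assume "of_integer 80640 = \<zero>"
  then have "int p dvd int (2 ^ 8 * 3 ^ 2 * 5 * 7)" by (simp add: of_integer_eq_0_iff)
  then have "p dvd 2 ^ 8 * 3 ^ 2 * 5 * 7" by (simp only: int_dvd_int_iff)
  then have "p dvd 2 \<or> p dvd 3 \<or> p dvd 5 \<or> p dvd 7"
    by (simp only: prime_dvd_mult_iff[OF p_prime]) (blast dest: prime_dvd_power[OF p_prime])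
  then show False using p_gt_15 by (auto dest: dvd_imp_le)
qed


lemma run_inverse_prog:
  assumes xs: "length xs = 15" "set xs \<subseteq> K"
  shows "set (run L c inverse_prog xs) \<subseteq> K"
    and "of_coords L u v (run L c inverse_prog xs) =
      frobenius 5 p L (of_coords L u v xs) \<otimes> frobenius 10 p L (of_coords L u v xs)"
proof -
  define I where "I = inv (of_integer 80640)"
  have I: "I \<in> K" "of_integer 80640 \<otimes> I = \<one>"
    using subfield_m_inv[OF subfield_K, of "of_integer 80640"] denominator_nonzero
      of_integer_in_subring[OF subring_K] by (auto simp: I_def)
  have IL: "I \<in> carrier L" using I(1) by (rule K_carrier)
  have xm: "xs ! m \<in> K" if "m < 15" for m
    using that xs by auto
  define form where "form s = (\<Oplus>m\<in>{..<15}. of_integer (form_coeff s m) \<otimes> xs ! m)" for s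
  define y where "y m = (\<Oplus>s\<in>{..<54}. (of_integer (output_coeff m s) \<otimes> I) \<otimes> form s [^] (2::nat))" for m
  note K = subringE[OF subring_K] of_integer_in_subring[OF subring_K]
  have sum_K: "(\<Oplus>i\<in>{..<n}. f i) \<in> K" if "\<And>i. i < n \<Longrightarrow> f i \<in> K" for f and n :: nat
    using that
  proof (induction n)
    case (Suc n)
    then have "(\<Oplus>i\<in>{..<Suc n}. f i) = (\<Oplus>i\<in>{..<n}. f i) \<oplus> f n"
      using K_carrier by (intro finsum_lessThan_Suc) simp
    with Suc show ?case using K(7) by simp
  qed (simp add: K finsum_zero)
  have form_K: "form s \<in> K" for s
    unfolding form_def using xm K(6,8) by (intro sum_K) simp
  have y_K: "y m \<in> K" for m
    unfolding y_def using form_K I(1) K(6,8) by (intro sum_K) (simp add: pow_in_K)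
  have formL: "form s \<in> carrier L" for s using form_K by (rule K_carrier)
  have "set xs \<subseteq> carrier L" using xs(2) K_carrier by blast
  moreover have rat: "rat_const L (of_int z / 80640) = of_integer z \<otimes> I" for z
    using rat_const_fraction(2)[OF denominator_nonzero, of z] by (simp add: I_def)
  ultimately have run: "run L c inverse_prog xs = map y [0..<15]"
    unfolding inverse_prog_def y_def form_def
    using xs(1) IL by (subst run_quad_prog) (auto simp: rat rat_const_int)
  then show sub: "set (run L c inverse_prog xs) \<subseteq> K"
    using y_K by auto
  \<comment> \<open>The output coordinates are collected into one weight \<open>\<Phi> s\<close> in \<open>L\<close> for each square. It factors
    into a part \<open>\<Omega>\<close> for the node and a part \<open>\<Psi>\<close> for the polynomial that is squared.\<close>
  define \<Phi> where "\<Phi> s = (\<Oplus>m\<in>{..<15}. of_integer (output_coeff m s) \<otimes> v [^] m)" for s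
  have \<Phi>_closed: "\<Phi> s \<in> carrier L" for s
    using v_carrier by (auto simp: \<Phi>_def intro!: finsum_closed)
  define \<Omega> where "\<Omega> t = (\<Oplus>k\<in>{..<9}. of_integer (lagrange t k) \<otimes> u [^] k)" for t
  define \<Psi> where "\<Psi> \<beta> = (\<Oplus>r\<in>{..<5}. of_integer (square_coeff \<beta> r) \<otimes> v [^] r)" for \<beta>
  define \<sigma> where "\<sigma> \<beta> = (\<Oplus>j\<in>{..<3}. of_integer (summand_coeff \<beta> j) \<otimes> component xs j)" for \<beta>
  have closed: "\<Omega> t \<in> carrier L" "\<Psi> \<beta> \<in> carrier L" "\<sigma> \<beta> \<in> carrier L" for t \<beta>
    using u_carrier v_carrier component_closed[OF xs]
    by (auto simp: \<Omega>_def \<Psi>_def \<sigma>_def intro!: finsum_closed)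
  have "length (run L c inverse_prog xs) = 15" by (simp add: run)
  from of_coords_eq[OF this sub]
  have "of_coords L u v (run L c inverse_prog xs) = (\<Oplus>m\<in>{..<15}. y m \<otimes> v [^] m)"
    using y_K K_carrier v_carrier by (auto simp: run intro!: finsum_cong')
  also have "\<dots> = (\<Oplus>m\<in>{..<15}. \<Oplus>s\<in>{..<54}. (of_integer (output_coeff m s) \<otimes> v [^] m) \<otimes>
      (I \<otimes> form s [^] (2::nat)))"
  proof (rule finsum_cong')
    fix m :: nat
    have "y m \<otimes> v [^] m = (\<Oplus>s\<in>{..<54}. ((of_integer (output_coeff m s) \<otimes> I) \<otimes> form s [^] (2::nat)) \<otimes>
        v [^] m)"
      unfolding y_def using formL IL v_carrier by (intro finsum_ldistr) auto
    also have "\<dots> = (\<Oplus>s\<in>{..<54}. (of_integer (output_coeff m s) \<otimes> v [^] m) \<otimes>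
        (I \<otimes> form s [^] (2::nat)))"
      using formL IL v_carrier by (intro finsum_cong') (auto simp: m_ac)
    finally show "y m \<otimes> v [^] m = (\<Oplus>s\<in>{..<54}. (of_integer (output_coeff m s) \<otimes> v [^] m) \<otimes>
        (I \<otimes> form s [^] (2::nat)))" .
  qed (use formL IL v_carrier in \<open>auto intro!: finsum_closed\<close>)
  also have "\<dots> = (\<Oplus>s\<in>{..<54}. \<Oplus>m\<in>{..<15}. (of_integer (output_coeff m s) \<otimes> v [^] m) \<otimes>
      (I \<otimes> form s [^] (2::nat)))"
    using formL IL v_carrier by (intro finsum_swap) auto
  also have "\<dots> = (\<Oplus>s\<in>{..<6 * 9}. \<Phi> s \<otimes> (I \<otimes> form s [^] (2::nat)))"
    unfolding \<Phi>_def using formL IL v_carrier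
    by (intro finsum_cong' finsum_ldistr[symmetric]) (auto intro!: finsum_closed)
  also have "\<dots> = (\<Oplus>\<beta>\<in>{..<6}. \<Oplus>t\<in>{..<9}. \<Phi> (9 * \<beta> + t) \<otimes> (I \<otimes> form (9 * \<beta> + t) [^] (2::nat)))"
    using formL IL \<Phi>_closed by (intro finsum_split_blocks) auto
  also have "\<dots> = (\<Oplus>\<beta>\<in>{..<6}. (I \<otimes> of_integer 40320) \<otimes> (\<Psi> \<beta> \<otimes> \<sigma> \<beta> [^] (2::nat)))"
  proof (rule finsum_cong')
    fix \<beta> :: nat assume \<beta>: "\<beta> \<in> {..<6}"
    define b where "b i = (\<Oplus>j\<in>{..<3}. of_integer (summand_coeff \<beta> j) \<otimes> xs ! (3 * i + j))" for i
    define T where "T t = of_integer (int t)" for t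
    have b: "b i \<in> carrier L" if "i < 5" for i
    proof -
      have "xs ! (3 * i + j) \<in> carrier L" if "j < 3" for j
        using that \<open>i < 5\<close> by (intro K_carrier xm) simp
      then show ?thesis by (auto simp: b_def intro!: finsum_closed)
    qed
    have T: "T t \<in> carrier L" for t by (simp add: T_def)
    have \<sigma>_eq: "\<sigma> \<beta> = (\<Oplus>i\<in>{..<5}. b i \<otimes> u [^] i)"
      unfolding \<sigma>_def b_def by (rule summand_sum[OF xs, symmetric])
    have "(\<Oplus>t\<in>{..<9}. \<Phi> (9 * \<beta> + t) \<otimes> (I \<otimes> form (9 * \<beta> + t) [^] (2::nat))) =
        (\<Oplus>t\<in>{..<9}. (I \<otimes> \<Psi> \<beta>) \<otimes> (\<Omega> t \<otimes> (\<Oplus>i\<in>{..<5}. b i \<otimes> T t [^] i) [^] (2::nat)))"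
    proof (rule finsum_cong')
      fix t :: nat assume t: "t \<in> {..<9}"
      have "\<Phi> (9 * \<beta> + t) = \<Omega> t \<otimes> \<Psi> \<beta>"
        unfolding \<Phi>_def \<Omega>_def \<Psi>_def using \<beta> t by (intro output_coeff_sum) auto
      moreover have "form (9 * \<beta> + t) = (\<Oplus>i\<in>{..<5}. b i \<otimes> T t [^] i)"
        unfolding form_def b_def T_def using \<beta> t by (intro form_coeff_sum[OF xs]) auto
      moreover have "(\<Oplus>i\<in>{..<5}. b i \<otimes> T t [^] i) \<in> carrier L"
        using b T by (auto intro!: finsum_closed)
      ultimately show "\<Phi> (9 * \<beta> + t) \<otimes> (I \<otimes> form (9 * \<beta> + t) [^] (2::nat)) =
          (I \<otimes> \<Psi> \<beta>) \<otimes> (\<Omega> t \<otimes> (\<Oplus>i\<in>{..<5}. b i \<otimes> T t [^] i) [^] (2::nat))"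
        using IL closed by (simp add: m_ac)
    qed (use IL closed b T in \<open>auto intro!: finsum_closed\<close>)
    also have "\<dots> = (I \<otimes> \<Psi> \<beta>) \<otimes> (\<Oplus>t\<in>{..<9}. \<Omega> t \<otimes> (\<Oplus>i\<in>{..<5}. b i \<otimes> T t [^] i) [^] (2::nat))"
      using IL closed b T by (intro finsum_rdistr[symmetric]) (auto intro!: finsum_closed)
    also have "(\<Oplus>t\<in>{..<9}. \<Omega> t \<otimes> (\<Oplus>i\<in>{..<5}. b i \<otimes> T t [^] i) [^] (2::nat)) =
        of_integer 40320 \<otimes> \<sigma> \<beta> [^] (2::nat)"
      unfolding \<sigma>_eq
    proof (rule quadrature_square)
      show "(\<Oplus>t\<in>{..<9}. \<Omega> t \<otimes> T t [^] n) = of_integer 40320 \<otimes> u [^] n"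
          if "n < 2 * 5 - 1" for n :: nat
        unfolding \<Omega>_def T_def using that by (intro lagrange_quadrature) simp
    qed (use closed T b u_carrier in auto)
    finally show "(\<Oplus>t\<in>{..<9}. \<Phi> (9 * \<beta> + t) \<otimes> (I \<otimes> form (9 * \<beta> + t) [^] (2::nat))) =
        (I \<otimes> of_integer 40320) \<otimes> (\<Psi> \<beta> \<otimes> \<sigma> \<beta> [^] (2::nat))"
      using IL closed by (simp add: m_ac)
  qed (use IL closed in auto)
  also have "\<dots> = (I \<otimes> of_integer 40320) \<otimes> (\<Oplus>\<beta>\<in>{..<6}. \<Psi> \<beta> \<otimes> \<sigma> \<beta> [^] (2::nat))"
    using IL closed by (intro finsum_rdistr[symmetric]) auto
  also have "(\<Oplus>\<beta>\<in>{..<6}. \<Psi> \<beta> \<otimes> \<sigma> \<beta> [^] (2::nat)) =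
      of_integer 2 \<otimes> (frobenius 5 p L (of_coords L u v xs) \<otimes> frobenius 10 p L (of_coords L u v xs))"
    unfolding \<Psi>_def \<sigma>_def by (rule squares_sum[OF xs])
  also have "(I \<otimes> of_integer 40320) \<otimes> \<dots> =
      (of_integer 80640 \<otimes> I) \<otimes>
      (frobenius 5 p L (of_coords L u v xs) \<otimes> frobenius 10 p L (of_coords L u v xs))"
  proof -
    have "of_coords L u v xs \<in> carrier L"
      unfolding of_coords_eq[OF xs] using xm K_carrier v_carrier by (auto intro!: finsum_closed)
    moreover have "of_integer 80640 = of_integer 40320 \<otimes> of_integer 2"
      by (simp flip: of_integer_mult)
    ultimately show ?thesis using IL by (simp add: frobenius_def m_ac)
  qed
  also have "\<dots> = frobenius 5 p L (of_coords L u v xs) \<otimes> frobenius 10 p L (of_coords L u v xs)"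
  proof -
    have "of_coords L u v xs \<in> carrier L"
      unfolding of_coords_eq[OF xs] using xm K_carrier v_carrier by (auto intro!: finsum_closed)
    then show ?thesis by (simp add: I(2) frobenius_def)
  qed
  finally show "of_coords L u v (run L c inverse_prog xs) =
      frobenius 5 p L (of_coords L u v xs) \<otimes> frobenius 10 p L (of_coords L u v xs)" .
qed

lemma rats_defined_inverse_prog: "rats_defined L inverse_prog"
  unfolding rats_defined_def
proof (intro allI impI)
  fix q i assume "Scale q i \<in> set (fst inverse_prog)"
  then consider z where "q = of_int z / of_int 1" | z where "q = of_int z / of_int 80640"
    unfolding inverse_prog_def by (fastforce dest!: quad_prog_Scale intro: of_int_0[symmetric])
  then show "add_pow L (snd (quotient_of q)) \<one> \<noteq> \<zero>"
    using rat_const_fraction(1)[of 1] rat_const_fraction(1)[OF denominator_nonzero]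
    by cases (simp_all only: of_integer_def[symmetric] of_integer_1 one_not_zero not_False_eq_True)
qed

end

lemma costs_inverse:
  "costs (G_phi3 :: nat \<Rightarrow> 'a ring \<Rightarrow> 'a set) (\<lambda>p L \<alpha>. inv\<^bsub>L\<^esub> \<alpha>) 0 54"
  unfolding costs_def
proof (intro exI[of _ inverse_prog] conjI allI impI)
  show "wf_slp inverse_prog" "num_mults inverse_prog \<le> 0" "num_squares inverse_prog \<le> 54"
    by (simp_all add: inverse_prog_def wf_quad_prog num_mults_quad_prog num_squares_quad_prog)
  fix p K u v and L :: "'a ring"
  assume "tower15 L p K u v"
  then interpret tower15 L p K u v .
  show "rats_defined L inverse_prog" by (rule rats_defined_inverse_prog)
  have "computes L K u v (\<lambda>_. \<zero>\<^bsub>L\<^esub>) inverse_prog (G_phi3 p L) (\<lambda>\<alpha>. inv\<^bsub>L\<^esub> \<alpha>)"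
    unfolding computes_def by (simp add: run_inverse_prog G_phi3_inv)
  moreover have "range (\<lambda>_ :: nat. \<zero>\<^bsub>L\<^esub>) \<subseteq> K"
    using subringE(2)[OF subring_K] by auto
  ultimately show "\<exists>c. range c \<subseteq> K \<and> computes L K u v c inverse_prog (G_phi3 p L) (\<lambda>\<alpha>. inv\<^bsub>L\<^esub> \<alpha>)"
    by blast
qed

theorem lemma3p3:
  shows "(\<forall>i \<in> {5, 10}.
            costs (\<lambda>p (L :: 'a ring). carrier L) (frobenius i) 10 0) \<and>
         (\<forall>i \<in> {1, 2, 3, 4, 6, 7, 8, 9}.
            costs (\<lambda>p (L :: 'a ring). carrier L) (frobenius i) 14 0) \<and>
         (\<forall>p (L :: 'a ring) K u v. tower15 L p K u v \<longrightarrow>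
            (\<forall>\<alpha> \<in> G_phi3 p L.
               inv\<^bsub>L\<^esub> \<alpha> = frobenius 5 p L \<alpha> \<otimes>\<^bsub>L\<^esub> frobenius 10 p L \<alpha>)) \<and>
         costs (G_phi3 :: nat \<Rightarrow> 'a ring \<Rightarrow> 'a set) (\<lambda>p L \<alpha>. inv\<^bsub>L\<^esub> \<alpha>) 0 54"
proof (intro conjI ballI allI impI)
  fix i :: nat assume "i \<in> {5, 10}"
  then have "5 dvd i" by auto
  then show "costs (\<lambda>p (L :: 'a ring). carrier L) (frobenius i) 10 0"
    by (rule costs_frobenius_10)
next
  fix p K u v \<alpha> and L :: "'a ring"
  assume "tower15 L p K u v" "\<alpha> \<in> G_phi3 p L"
  then show "inv\<^bsub>L\<^esub> \<alpha> = frobenius 5 p L \<alpha> \<otimes>\<^bsub>L\<^esub> frobenius 10 p L \<alpha>"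
    by (rule tower15.G_phi3_inv)
qed (rule costs_frobenius_14 costs_inverse)+

end
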